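(* Let $(b_n)_{n\ge1}$ be a real sequence and $T\in\mathbb{N}$, $T\ge1$. Let $\mathcal{T}_k$ be the polynomials defined by $\mathcal{T}_0=0$, $\mathcal{T}_1=1$, $\mathcal{T}_{k+1}(\lambda)+\mathcal{T}_{k-1}(\lambda)=\lambda\mathcal{T}_k(\lambda)$ for $k\ge 1$. Let $$B^T_J=\left\{F:\ F(\lambda)=\sum_{k=1}^T\mathcal{T}_k(\lambda)f_{T-k},\ f=(f_0,\ldots,f_{T-1})\in\mathbb{C}^T\right\},$$ equipped with the scalar product $[F,G]_{B^T_J}=(C^Tf,g)_{\mathbb{C}^T}$, where $f,g$ represent $F,G$ and $C^T$ is the connecting operator of the discrete dynamical system with potential $(b_n)$. Then $B^T_J$ is a Hilbert space and is a De Branges space, i.e. there is a Hermite-Biehler function $E$ such that $B_J^T=B(E)$ as sets with equal norms. Moreover, for every $z\in\mathbb{C}$ the equation $$C^Tj^z=\overline{\left(\mathcal{T}_T(z),\mathcal{T}_{T-1}(z),\ldots,\mathcal{T}_1(z)\right)^{\top}}$$ has a unique solution $j^z=(j^z_0,\ldots,j^z_{T-1})^{\top}\in\mathbb{C}^T$, and the reproducing kernel of $B^T_J$, i.e. the function $J_z\in B^T_J$ with $[J_z,F]_{B^T_J}=F(z)$ for all $F\in B^T_J$, is $$J_z(\lambda)=\sum_{k=1}^T\mathcal{T}_k(\lambda)j^z_{T-k}.$$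
   Context: Scalar products are conjugate-linear in the first argument: on controls $(f,g)=\sum_{k=0}^{T-1}\overline{f_k}g_k$, on states $(h,l)=\sum_{k=1}^{T}\overline{h_k}l_k$. Discrete dynamical system: for a complex sequence $f=(f_0,f_1,\ldots)$ let $u^f_{n,t}$ be the solution of $u_{n,t+1}+u_{n,t-1}-u_{n+1,t}-u_{n-1,t}-b_nu_{n,t}=0$ for $n\ge1$, $t\ge0$, with $u_{n,-1}=u_{n,0}=0$ for $n\ge1$ and $u_{0,t}=f_t$ for $t\ge0$. The control operator $W^T:\mathbb{C}^T\to\mathbb{C}^T$ maps $f=(f_0,\ldots,f_{T-1})$ to $(u^f_{n,T})_{n=1}^T$ (these values depend only on $f_0,\dots,f_{T-1}$), and the connecting operator is $C^T=(W^T)^*W^T$. An entire function $E$ is a Hermite-Biehler function if $|E(z)|>|E(\overline z)|$ for $\operatorname{Im}z>0$. Put $F^\#(z)=\overline{F(\overline z)}$, and let $H_2$ be the Hardy space of functions $f$ holomorphic in the upper half-plane with $\sup_{y>0}\int_{-\infty}^\infty|f(x+iy)|^2dx<\infty$. The De Branges space $B(E)$ is the set of entire functions $F$ with $\int_{\mathbb{R}}|F(\lambda)/E(\lambda)|^2d\lambda<\infty$ and $F/E,\ F^\#/E\in H_2$, with scalar product $[F,G]_{B(E)}=\frac1\pi\int_{\mathbb{R}}\overline{F(\lambda)}G(\lambda)\frac{d\lambda}{|E(\lambda)|^2}$. *)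

theory Defs
  imports
    "HOL-Analysis.Analysis"
    "Jordan_Normal_Form.Schur_Decomposition"
begin

unbundle no vec_syntax
hide_const (open) Finite_Cartesian_Product.vec Finite_Cartesian_Product.mat

section \<open>The discrete dynamical system\<close>

text \<open>
  Time ranges over the integers so that the initial layer \<open>t = -1\<close> can be stated literally.
  The value \<open>b 0\<close> of the potential and the value of \<open>u 0 (-1)\<close> are never used.
\<close>

definition solves_system :: "(nat \<Rightarrow> real) \<Rightarrow> (nat \<Rightarrow> complex) \<Rightarrow> (nat \<Rightarrow> int \<Rightarrow> complex) \<Rightarrow> bool" where
  "solves_system b f u \<longleftrightarrow>
     (\<forall>n\<ge>1. \<forall>t\<ge>0. u n (t + 1) + u n (t - 1) - u (n + 1) t - u (n - 1) t
                     - complex_of_real (b n) * u n t = 0) \<and>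
     (\<forall>n\<ge>1. u n (-1) = 0 \<and> u n 0 = 0) \<and>
     (\<forall>t. u 0 (int t) = f t)"

text \<open>The solution at times \<open>t \<ge> 0\<close>, computed layer by layer; see \<open>solves_system_iff\<close> below.\<close>

fun dsol :: "(nat \<Rightarrow> real) \<Rightarrow> (nat \<Rightarrow> complex) \<Rightarrow> nat \<Rightarrow> nat \<Rightarrow> complex" where
  "dsol b f 0 t = f t"
| "dsol b f (Suc n) 0 = 0"
| "dsol b f (Suc n) (Suc 0) =
     dsol b f (n + 2) 0 + dsol b f n 0 + complex_of_real (b (Suc n)) * dsol b f (Suc n) 0"
| "dsol b f (Suc n) (Suc (Suc t)) =
     dsol b f (n + 2) (Suc t) + dsol b f n (Suc t)
       + complex_of_real (b (Suc n)) * dsol b f (Suc n) (Suc t) - dsol b f (Suc n) t"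

lemma solves_system_dsol:
  "solves_system b f (\<lambda>n t. if t < 0 then 0 else dsol b f n (nat t))"
  unfolding solves_system_def
proof (intro conjI allI impI)
  fix n :: nat and t :: int
  assume n: "1 \<le> n" and t: "0 \<le> t"
  obtain m where m: "n = Suc m" using n by (cases n) auto
  obtain s where s: "t = int s" using t nonneg_int_cases by blast
  show "(if t + 1 < 0 then 0 else dsol b f n (nat (t + 1)))
      + (if t - 1 < 0 then 0 else dsol b f n (nat (t - 1)))
      - (if t < 0 then 0 else dsol b f (n + 1) (nat t))
      - (if t < 0 then 0 else dsol b f (n - 1) (nat t))
      - complex_of_real (b n) * (if t < 0 then 0 else dsol b f n (nat t)) = 0"
  proof (cases s)
    case 0
    then show ?thesis by (simp add: m s)
  next
    case (Suc r)
    have "nat (1 + int r) = Suc r" "nat (int r + 1) = Suc r"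
         "nat (2 + int r) = Suc (Suc r)" "nat (int r + 2) = Suc (Suc r)" by auto
    then show ?thesis by (simp add: m s Suc)
  qed
next
  fix n :: nat assume "1 \<le> n"
  then show "(if (0::int) < 0 then 0 else dsol b f n (nat 0)) = 0" by (cases n) auto
qed auto

lemma solves_system_unique:
  assumes "solves_system b f u"
  shows "u n (int t) = dsol b f n t"
proof (induction t arbitrary: n rule: less_induct)
  case (less t)
  have eqn: "u n (t + 1) = u (n + 1) t + u (n - 1) t + complex_of_real (b n) * u n t - u n (t - 1)"
    if "n \<ge> 1" "t \<ge> 0" for n :: nat and t :: int
  proof -
    have "u n (t + 1) + u n (t - 1) - u (n + 1) t - u (n - 1) t - complex_of_real (b n) * u n t = 0"
      using assms that unfolding solves_system_def by blast
    then show ?thesis by (simp add: algebra_simps)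
  qed
  have init: "u (Suc m) (-1) = 0" "u (Suc m) 0 = 0" for m
    using assms unfolding solves_system_def by auto
  have bdry: "u 0 (int s) = f s" for s
    using assms unfolding solves_system_def by auto
  show ?case
  proof (cases n)
    case 0
    then show ?thesis using bdry by simp
  next
    case n: (Suc m)
    show ?thesis
    proof (cases t)
      case 0
      then show ?thesis using n init by simp
    next
      case t: (Suc s)
      have "u n (int t) = u (n + 1) (int s) + u (n - 1) (int s)
              + complex_of_real (b n) * u n (int s) - u n (int s - 1)"
        using eqn[of n "int s"] n t by (simp add: add.commute)
      moreover have "u k (int s) = dsol b f k s" for k
        using less t by simp
      ultimately have *: "u n (int t) = dsol b f (n + 1) s + dsol b f m s
              + complex_of_real (b n) * dsol b f n s - u n (int s - 1)"
        using n by simp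
      show ?thesis
      proof (cases s)
        case 0
        then show ?thesis using * n t init by simp
      next
        case (Suc r)
        then have "u n (int s - 1) = dsol b f n r"
          using less[of r n] t by simp
        then show ?thesis using * n t Suc by simp
      qed
    qed
  qed
qed

lemma solves_system_iff:
  "solves_system b f u \<longleftrightarrow>
     (\<forall>n t. u n (int t) = dsol b f n t) \<and> (\<forall>n\<ge>1. u n (-1) = 0)"
proof
  assume "solves_system b f u"
  then show "(\<forall>n t. u n (int t) = dsol b f n t) \<and> (\<forall>n\<ge>1. u n (-1) = 0)"
    using solves_system_unique by (auto simp: solves_system_def)
next
  assume u: "(\<forall>n t. u n (int t) = dsol b f n t) \<and> (\<forall>n\<ge>1. u n (-1) = 0)"
  define v where "v = (\<lambda>n (t::int). if t < 0 then 0 else dsol b f n (nat t))"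
  have eq: "u n t = v n t" if "t \<ge> 0" for n t
    using u that by (metis v_def nat_0_le not_less)
  have eq': "u n (t - 1) = v n (t - 1)" if "t \<ge> 0" "n \<ge> 1" for n t
  proof (cases "t = 0")
    case True
    then show ?thesis using u that by (simp add: v_def)
  qed (use that eq in auto)
  have "solves_system b f v" unfolding v_def by (rule solves_system_dsol)
  then show "solves_system b f u"
    using u eq eq' unfolding solves_system_def by (auto simp: v_def)
qed

text \<open>The solution at time \<open>T\<close> does not see \<open>f t\<close> for \<open>t \<ge> T\<close>.\<close>

lemma dsol_causal:
  assumes "\<And>k. k < T \<Longrightarrow> f k = g k" and "n \<ge> 1"
  shows "dsol b f n T = dsol b g n T"
proof -
  have "dsol b f n t = dsol b g n t" if "t < T \<or> (t = T \<and> n \<ge> 1)" for n t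
    using that assms(1)
  proof (induction b f n t rule: dsol.induct)
    case (1 b f t)
    then show ?case by auto
  next
    case (2 b f n)
    then show ?case by simp
  next
    case (3 b f n)
    then show ?case by auto
  next
    case (4 b f n t)
    then show ?case by auto
  qed
  then show ?thesis using assms(2) by blast
qed

lemma dsol_linear:
  "dsol b (\<lambda>k. \<Sum>j\<in>S. c j * f j k) n t = (\<Sum>j\<in>S. c j * dsol b (f j) n t)"
  by (induction b "f undefined" n t rule: dsol.induct)
     (auto simp: algebra_simps sum.distrib sum_subtractf sum_distrib_left)

section \<open>Control operator and connecting operator\<close>

definition cscalar :: "complex vec \<Rightarrow> complex vec \<Rightarrow> complex" where
  "cscalar f g = (\<Sum>k<dim_vec g. cnj (f $ k) * g $ k)"

text \<open>Entry \<open>i\<close> of \<open>control_op b T f\<close> is the state \<open>u\<^sup>f\<close> at site \<open>i + 1\<close> and time \<open>T\<close>.\<close>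

definition control_op :: "(nat \<Rightarrow> real) \<Rightarrow> nat \<Rightarrow> complex vec \<Rightarrow> complex vec" where
  "control_op b T f =
     Matrix.vec T (\<lambda>i. dsol b (\<lambda>k. if k < T then f $ k else 0) (i + 1) T)"

definition control_mat :: "(nat \<Rightarrow> real) \<Rightarrow> nat \<Rightarrow> complex mat" where
  "control_mat b T = Matrix.mat T T (\<lambda>(i, j). control_op b T (unit_vec T j) $ i)"

definition connecting_mat :: "(nat \<Rightarrow> real) \<Rightarrow> nat \<Rightarrow> complex mat" where
  "connecting_mat b T = mat_adjoint (control_mat b T) * control_mat b T"

lemma control_mat_carrier: "control_mat b T \<in> carrier_mat T T"
  by (simp add: control_mat_def)

lemma control_mat_mult_vec:
  assumes "f \<in> carrier_vec T"
  shows "control_mat b T *\<^sub>v f = control_op b T f"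
proof (rule eq_vecI)
  show "dim_vec (control_mat b T *\<^sub>v f) = dim_vec (control_op b T f)"
    by (simp add: control_mat_def control_op_def)
next
  fix i assume "i < dim_vec (control_op b T f)"
  then have i: "i < T" by (simp add: control_op_def)
  have expand: "(\<lambda>k. if k < T then f $ k else 0) =
      (\<lambda>k. \<Sum>j\<in>{..<T}. f $ j * (if k < T then (unit_vec T j :: complex vec) $ k else 0))"
  proof
    fix k
    show "(if k < T then f $ k else 0) =
      (\<Sum>j\<in>{..<T}. f $ j * (if k < T then (unit_vec T j :: complex vec) $ k else 0))"
    proof (cases "k < T")
      case True
      have "(\<Sum>j\<in>{..<T}. f $ j * (if k < T then (unit_vec T j :: complex vec) $ k else 0))
          = (\<Sum>j\<in>{..<T}. if j = k then f $ j else 0)"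
        using True by (intro sum.cong) (auto simp: unit_vec_def)
      then show ?thesis using True by simp
    qed simp
  qed
  have "(control_mat b T *\<^sub>v f) $ i =
      (\<Sum>j<T. f $ j * dsol b (\<lambda>k. if k < T then (unit_vec T j :: complex vec) $ k else 0) (i + 1) T)"
    using i assms
    by (simp add: control_mat_def control_op_def scalar_prod_def row_def atLeast0LessThan
          mult.commute del: index_unit_vec)
  also have "\<dots> = control_op b T f $ i"
    unfolding control_op_def using i
    by (simp only: index_vec expand dsol_linear)
  finally show "(control_mat b T *\<^sub>v f) $ i = control_op b T f $ i" .
qed

lemma mat_adjoint_cscalar:
  assumes A: "A \<in> carrier_mat m n" and f: "f \<in> carrier_vec n" and h: "h \<in> carrier_vec m"
  shows "cscalar (mat_adjoint A *\<^sub>v h) f = cscalar h (A *\<^sub>v f)"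
proof -
  have adj: "mat_adjoint A = Matrix.mat n m (\<lambda>(i, j). cnj (A $$ (j, i)))"
    using A by (intro eq_matI) (auto simp: mat_adjoint_def mat_of_rows_def)
  have "cscalar (mat_adjoint A *\<^sub>v h) f = (\<Sum>k<n. \<Sum>j<m. A $$ (j, k) * cnj (h $ j) * f $ k)"
    using f h unfolding cscalar_def adj
    by (intro sum.cong)
       (auto simp: scalar_prod_def row_def atLeast0LessThan sum_distrib_right intro!: sum.cong)
  also have "\<dots> = (\<Sum>j<m. \<Sum>k<n. A $$ (j, k) * cnj (h $ j) * f $ k)"
    by (rule sum.swap)
  also have "\<dots> = cscalar h (A *\<^sub>v f)"
    using A f h unfolding cscalar_def
    by (auto simp: scalar_prod_def row_def atLeast0LessThan sum_distrib_left mult_ac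
             intro!: sum.cong)
  finally show ?thesis .
qed

lemma connecting_mat_cscalar:
  assumes "f \<in> carrier_vec T" "g \<in> carrier_vec T"
  shows "cscalar (connecting_mat b T *\<^sub>v f) g = cscalar (control_op b T f) (control_op b T g)"
proof -
  have W: "control_mat b T \<in> carrier_mat T T" by (rule control_mat_carrier)
  have "mat_adjoint (control_mat b T) \<in> carrier_mat T T"
    using W by (auto simp: mat_adjoint_def)
  then have "connecting_mat b T *\<^sub>v f = mat_adjoint (control_mat b T) *\<^sub>v (control_mat b T *\<^sub>v f)"
    unfolding connecting_mat_def using W assms(1) by (intro assoc_mult_mat_vec) auto
  then show ?thesis
    using mat_adjoint_cscalar[OF W assms(2), of "control_mat b T *\<^sub>v f"] W assms
    by (simp add: control_mat_mult_vec control_op_def)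
qed

section \<open>The space of the discrete system\<close>

fun Tpoly :: "nat \<Rightarrow> complex poly" where
  "Tpoly 0 = 0"
| "Tpoly (Suc 0) = 1"
| "Tpoly (Suc (Suc k)) = [:0, 1:] * Tpoly (Suc k) - Tpoly k"

definition Tsum :: "nat \<Rightarrow> complex vec \<Rightarrow> complex \<Rightarrow> complex" where
  "Tsum T f = (\<lambda>z. \<Sum>k=1..T. poly (Tpoly k) z * f $ (T - k))"

definition BJ :: "nat \<Rightarrow> (complex \<Rightarrow> complex) set" where
  "BJ T = {F. \<exists>f\<in>carrier_vec T. F = Tsum T f}"

text \<open>The unique representing control of \<open>F \<in> BJ T\<close>; see \<open>Tsum_inj\<close> and \<open>BJ_inner_Tsum\<close> below.\<close>

definition BJ_control :: "nat \<Rightarrow> (complex \<Rightarrow> complex) \<Rightarrow> complex vec" where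
  "BJ_control T F = (THE f. f \<in> carrier_vec T \<and> F = Tsum T f)"

definition BJ_inner ::
    "(nat \<Rightarrow> real) \<Rightarrow> nat \<Rightarrow> (complex \<Rightarrow> complex) \<Rightarrow> (complex \<Rightarrow> complex) \<Rightarrow> complex" where
  "BJ_inner b T F G = cscalar (connecting_mat b T *\<^sub>v BJ_control T F) (BJ_control T G)"

definition kernel_control :: "(nat \<Rightarrow> real) \<Rightarrow> nat \<Rightarrow> complex \<Rightarrow> complex vec \<Rightarrow> bool" where
  "kernel_control b T z j \<longleftrightarrow> j \<in> carrier_vec T \<and>
     connecting_mat b T *\<^sub>v j = Matrix.vec T (\<lambda>i. cnj (poly (Tpoly (T - i)) z))"

lemma Tpoly_degree: "degree (Tpoly (Suc k)) = k \<and> lead_coeff (Tpoly (Suc k)) = 1"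
proof (induction k rule: less_induct)
  case (less k)
  show ?case
  proof (cases k)
    case 0
    then show ?thesis by simp
  next
    case (Suc m)
    have m: "degree (Tpoly (Suc m)) = m" "coeff (Tpoly (Suc m)) m = 1"
      using less[of m] Suc by auto
    have d: "coeff (Tpoly m) i = 0" if "i \<ge> m" "i > 0" for i
    proof (cases m)
      case 0
      then show ?thesis by simp
    next
      case (Suc r)
      then have "degree (Tpoly m) = r" using less[of r] \<open>k = Suc m\<close> by auto
      then show ?thesis using that Suc by (intro coeff_eq_0) auto
    qed
    have c: "coeff (Tpoly (Suc k)) (Suc i) = coeff (Tpoly (Suc m)) i - coeff (Tpoly m) (Suc i)" for i
      by (simp add: Suc)
    have top: "coeff (Tpoly (Suc k)) k = 1"
      using c[of m] m d[of "Suc m"] Suc by simp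
    have "coeff (Tpoly (Suc k)) i = 0" if i: "i > k" for i
    proof -
      obtain j where j: "i = Suc j" using i by (cases i) auto
      have "coeff (Tpoly (Suc m)) j = 0" using m i j Suc by (intro coeff_eq_0) auto
      then show ?thesis using c[of j] d[of i] i j Suc by simp
    qed
    then have "degree (Tpoly (Suc k)) \<le> k" by (intro degree_le) auto
    moreover have "degree (Tpoly (Suc k)) \<ge> k" using top by (intro le_degree) auto
    ultimately show ?thesis using top by simp
  qed
qed

lemma Tpoly_independent:
  assumes "(\<Sum>k=1..T. Polynomial.smult (a k) (Tpoly k)) = 0" "k \<in> {1..T}"
  shows "a k = 0"
  using assms
proof (induction T)
  case (Suc T)
  have low: "coeff (Tpoly k) T = 0" if "k \<in> {1..T}" for k
  proof -
    obtain j where j: "k = Suc j" using \<open>k \<in> {1..T}\<close> by (cases k) auto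
    show ?thesis using Tpoly_degree[of j] that j by (intro coeff_eq_0) auto
  qed
  have "coeff (\<Sum>k=1..Suc T. Polynomial.smult (a k) (Tpoly k)) T
      = (\<Sum>k=1..T. a k * coeff (Tpoly k) T) + a (Suc T) * coeff (Tpoly (Suc T)) T"
    by (simp add: coeff_sum)
  also have "\<dots> = a (Suc T)"
    using low Tpoly_degree[of T] by (simp add: sum.neutral del: Tpoly.simps) metis
  finally have top: "a (Suc T) = 0" unfolding Suc.prems(1) by simp
  then show ?case
    using Suc by (cases "k = Suc T") auto
qed simp

lemma Tsum_inj:
  assumes f: "f \<in> carrier_vec T" and g: "g \<in> carrier_vec T" and eq: "Tsum T f = Tsum T g"
  shows "f = g"
proof (rule eq_vecI)
  let ?p = "\<Sum>k=1..T. Polynomial.smult (f $ (T - k) - g $ (T - k)) (Tpoly k)"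
  have "poly ?p z = Tsum T f z - Tsum T g z" for z
    by (simp add: Tsum_def poly_sum algebra_simps sum_subtractf)
  then have "poly ?p z = 0" for z
    using eq by simp
  then have p: "?p = 0"
    using poly_all_0_iff_0 by blast
  fix i assume "i < dim_vec g"
  then have i: "i < T" using g by simp
  have "f $ (T - (T - i)) - g $ (T - (T - i)) = 0"
    using Tpoly_independent[OF p, of "T - i"] i by simp
  then show "f $ i = g $ i" using i by simp
qed (use f g in simp)

lemma BJ_control_Tsum: "f \<in> carrier_vec T \<Longrightarrow> BJ_control T (Tsum T f) = f"
  unfolding BJ_control_def by (rule the_equality) (auto dest: Tsum_inj)

lemma BJ_inner_Tsum:
  assumes "f \<in> carrier_vec T" "g \<in> carrier_vec T"
  shows "BJ_inner b T (Tsum T f) (Tsum T g) = cscalar (connecting_mat b T *\<^sub>v f) g"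
  using assms by (simp add: BJ_inner_def BJ_control_Tsum)

section \<open>Hilbert spaces of functions and reproducing kernels\<close>

definition ip_norm ::
    "((complex \<Rightarrow> complex) \<Rightarrow> (complex \<Rightarrow> complex) \<Rightarrow> complex) \<Rightarrow> (complex \<Rightarrow> complex) \<Rightarrow> real" where
  "ip_norm ip F = sqrt (Re (ip F F))"

text \<open>The scalar product is conjugate-linear in the first argument.\<close>

definition hilbert_function_space ::
    "(complex \<Rightarrow> complex) set \<Rightarrow> ((complex \<Rightarrow> complex) \<Rightarrow> (complex \<Rightarrow> complex) \<Rightarrow> complex) \<Rightarrow> bool" where
  "hilbert_function_space V ip \<longleftrightarrow>
     (\<lambda>z. 0) \<in> V \<and>
     (\<forall>F\<in>V. \<forall>G\<in>V. (\<lambda>z. F z + G z) \<in> V) \<and>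
     (\<forall>c. \<forall>F\<in>V. (\<lambda>z. c * F z) \<in> V) \<and>
     (\<forall>F\<in>V. \<forall>G\<in>V. \<forall>H\<in>V. ip F (\<lambda>z. G z + H z) = ip F G + ip F H) \<and>
     (\<forall>c. \<forall>F\<in>V. \<forall>G\<in>V. ip F (\<lambda>z. c * G z) = c * ip F G) \<and>
     (\<forall>F\<in>V. \<forall>G\<in>V. ip G F = cnj (ip F G)) \<and>
     (\<forall>F\<in>V. Im (ip F F) = 0 \<and> Re (ip F F) \<ge> 0) \<and>
     (\<forall>F\<in>V. ip F F = 0 \<longrightarrow> F = (\<lambda>z. 0)) \<and>
     (\<forall>X. (\<forall>n. X n \<in> V) \<and>
          (\<forall>\<epsilon>>0. \<exists>N. \<forall>m\<ge>N. \<forall>n\<ge>N. ip_norm ip (\<lambda>z. X m z - X n z) < \<epsilon>) \<longrightarrow>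
          (\<exists>F\<in>V. (\<lambda>n::nat. ip_norm ip (\<lambda>z. X n z - F z)) \<longlonglongrightarrow> 0))"

definition reproducing_at ::
    "(complex \<Rightarrow> complex) set \<Rightarrow> ((complex \<Rightarrow> complex) \<Rightarrow> (complex \<Rightarrow> complex) \<Rightarrow> complex) \<Rightarrow>
     complex \<Rightarrow> (complex \<Rightarrow> complex) \<Rightarrow> bool" where
  "reproducing_at V ip z K \<longleftrightarrow> K \<in> V \<and> (\<forall>F\<in>V. ip K F = F z)"

section \<open>De Branges spaces\<close>

definition hermite_biehler :: "(complex \<Rightarrow> complex) \<Rightarrow> bool" where
  "hermite_biehler E \<longleftrightarrow>
     E holomorphic_on UNIV \<and> (\<forall>z. Im z > 0 \<longrightarrow> cmod (E z) > cmod (E (cnj z)))"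

definition hardy_H2 :: "(complex \<Rightarrow> complex) set" where
  "hardy_H2 = {f. f holomorphic_on {z. Im z > 0} \<and>
     (SUP y\<in>{0<..}. \<integral>\<^sup>+x. ennreal ((cmod (f (Complex x y)))\<^sup>2) \<partial>lborel) < \<infinity>}"

definition sharp :: "(complex \<Rightarrow> complex) \<Rightarrow> complex \<Rightarrow> complex" where
  "sharp F = (\<lambda>z. cnj (F (cnj z)))"

text \<open>
  A Hermite-Biehler function may have real zeros; there the integrands below take the value 0
  by the convention for division, which does not matter since these zeros are a null set.
\<close>

definition de_branges :: "(complex \<Rightarrow> complex) \<Rightarrow> (complex \<Rightarrow> complex) set" where
  "de_branges E = {F. F holomorphic_on UNIV \<and>
     (\<integral>\<^sup>+x. ennreal ((cmod (F (complex_of_real x) / E (complex_of_real x)))\<^sup>2) \<partial>lborel) < \<infinity> \<and>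
     (\<lambda>z. F z / E z) \<in> hardy_H2 \<and> (\<lambda>z. sharp F z / E z) \<in> hardy_H2}"

definition de_branges_inner ::
    "(complex \<Rightarrow> complex) \<Rightarrow> (complex \<Rightarrow> complex) \<Rightarrow> (complex \<Rightarrow> complex) \<Rightarrow> complex" where
  "de_branges_inner E F G = complex_of_real (1 / pi) *
     (\<integral>x. cnj (F (complex_of_real x)) * G (complex_of_real x)
            / complex_of_real ((cmod (E (complex_of_real x)))\<^sup>2) \<partial>lborel)"

end

theory Submission
  imports Defs "HOL-Complex_Analysis.Complex_Analysis" "HOL-Probability.Sinc_Integral"
begin

text \<open>
  Let \<open>P\<^sub>0 = 0\<close>, \<open>P\<^sub>1 = 1\<close>, \<open>P\<^sub>n\<^sub>+\<^sub>2 = (\<lambda> - b\<^sub>n\<^sub>+\<^sub>1) P\<^sub>n\<^sub>+\<^sub>1 - P\<^sub>n\<close> be the orthogonal polynomials of the Jacobi matrix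
  with diagonal \<open>b\<close>. Summation by parts in the dynamical system shows that the function represented
  by a control \<open>f\<close> is \<open>\<Sum> (W\<^sup>T f)\<^sub>n P\<^sub>n\<close>; so the space consists of the polynomials of degree less than \<open>T\<close>,
  with \<open>P\<^sub>1, \<dots>, P\<^sub>T\<close> as an orthonormal basis. The Hermite-Biehler function is \<open>E = P\<^sub>T\<^sub>+\<^sub>1 + i P\<^sub>T\<close>, by
  the Christoffel-Darboux formula. On the real line \<open>P\<^sub>n P\<^sub>T\<^sub>+\<^sub>1 / |E|\<^sup>2\<close> and \<open>P\<^sub>n P\<^sub>T / |E|\<^sup>2\<close> are
  \<open>Re (P\<^sub>n / E)\<close> and \<open>- Im (P\<^sub>n / E)\<close>, whose integrals follow from Cauchy's theorem as \<open>E\<close> has no zeros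
  in the closed upper half-plane; descending with the recurrence, \<open>P\<^sub>1, \<dots>, P\<^sub>T\<close> are orthonormal for
  \<open>d\<lambda> / (\<pi> |E|\<^sup>2)\<close> as well. Conversely, if \<open>F / E\<close> and \<open>F\<^sup># / E\<close> are in \<open>H\<^sub>2\<close>, then
  \<open>|F z| \<le> C (1 + |z|)\<^sup>T / sqrt |Im z|\<close>, which makes \<open>F\<close> a polynomial of degree less than \<open>T\<close>.
\<close>

section \<open>Orthogonal polynomials and the dynamical system\<close>

text \<open>Subtracting \<open>coeff p N\<close> times \<open>q N\<close> removes the top
  coefficient. Bounding coefficients instead of the degree lets \<open>N = 0\<close> mean
  \<open>p = 0\<close>.\<close>

lemma monic_family_span:
  fixes q :: "nat \<Rightarrow> 'a :: comm_ring_1 poly"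
  assumes q: "\<And>n. degree (q n) = n" "\<And>n. lead_coeff (q n) = 1" and p: "\<And>i. i \<ge> N \<Longrightarrow> coeff p i = 0"
  shows "\<exists>c. p = (\<Sum>n<N. Polynomial.smult (c n) (q n))"
  using p
proof (induction N arbitrary: p)
  case 0
  then show ?case by (simp add: poly_eq_iff)
next
  case (Suc N)
  let ?r = "p - Polynomial.smult (coeff p N) (q N)"
  have "coeff ?r i = 0" if "i \<ge> N" for i
    using that Suc.prems[of i] q[of N] by (cases "i = N") (auto simp: coeff_eq_0)
  then obtain c where c: "?r = (\<Sum>n<N. Polynomial.smult (c n) (q n))"
    using Suc.IH by blast
  have "p = (\<Sum>n<Suc N. Polynomial.smult ((c(N := coeff p N)) n) (q n))"
    using c by (simp add: algebra_simps)
  then show ?case by blast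
qed

text \<open>The top coefficient of the sum sees only the last summand, so the scalars vanish one
  after another from the top.\<close>

lemma monic_family_independent:
  fixes q :: "nat \<Rightarrow> 'a :: comm_ring_1 poly"
  assumes q: "\<And>n. degree (q n) = n" "\<And>n. lead_coeff (q n) = 1"
    and 0: "(\<Sum>n<N. Polynomial.smult (c n) (q n)) = 0" and n: "n < N"
  shows "c n = 0"
  using 0 n
proof (induction N)
  case (Suc N)
  have "coeff (\<Sum>n<Suc N. Polynomial.smult (c n) (q n)) N = c N"
    using q by (simp add: coeff_sum coeff_eq_0)
  then have "c N = 0" by (simp only: Suc.prems(1) coeff_0)
  then show ?case using Suc by (cases "n = N") auto
qed simp

fun Ppoly :: "(nat \<Rightarrow> real) \<Rightarrow> nat \<Rightarrow> complex poly" where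
  "Ppoly b 0 = 0"
| "Ppoly b (Suc 0) = 1"
| "Ppoly b (Suc (Suc n)) =
     [:- complex_of_real (b (Suc n)), 1:] * Ppoly b (Suc n) - Ppoly b n"

lemma poly_Ppoly_step:
  "poly (Ppoly b (Suc (Suc n))) z =
     (z - complex_of_real (b (Suc n))) * poly (Ppoly b (Suc n)) z - poly (Ppoly b n) z"
  by (simp add: algebra_simps)

lemma Ppoly_monic: "degree (Ppoly b (Suc n)) = n \<and> lead_coeff (Ppoly b (Suc n)) = 1"
proof (induction n rule: less_induct)
  case (less n)
  show ?case
  proof (cases n)
    case 0
    then show ?thesis by simp
  next
    case (Suc m)
    let ?q = "[:- complex_of_real (b (Suc m)), 1:] * Ppoly b (Suc m)"
    have m: "degree (Ppoly b (Suc m)) = m" "lead_coeff (Ppoly b (Suc m)) = 1"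
      using less[of m] Suc by auto
    have ne: "Ppoly b (Suc m) \<noteq> 0" using m(2) by auto
    have q: "degree ?q = Suc m" "lead_coeff ?q = 1"
      using m ne by (subst degree_mult_eq lead_coeff_mult; simp)+
    \<comment> \<open>The case \<open>m = 0\<close> is separate because P_0 = 0 is not of the monic
      form covered by the induction.\<close>
    have small: "degree (Ppoly b m) < Suc m"
    proof (cases m)
      case (Suc r)
      then show ?thesis using less[of r] \<open>n = Suc m\<close> by simp
    qed simp
    have "degree (?q - Ppoly b m) = Suc m" "lead_coeff (?q - Ppoly b m) = 1"
      using q small degree_add_eq_left[of "- Ppoly b m" ?q]
        lead_coeff_add_le[of "- Ppoly b m" ?q]
      by (simp_all del: mult_pCons_left)
    then show ?thesis by (simp add: Suc)
  qed
qed

text \<open>The potential is real, so these polynomials have real coefficients.\<close>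

lemma cnj_poly_Ppoly: "cnj (poly (Ppoly b n) z) = poly (Ppoly b n) (cnj z)"
  by (induction b n rule: Ppoly.induct) (simp_all add: algebra_simps)

text \<open>When the factors of highest index are expanded by the recurrence, the terms with
  \<open>b\<close> cancel and the right side grows by \<open>z - w\<close> times the new
  summand.\<close>

lemma christoffel_darboux:
  "(z - w) * (\<Sum>k<n. poly (Ppoly b (Suc k)) z * poly (Ppoly b (Suc k)) w) =
     poly (Ppoly b (Suc n)) z * poly (Ppoly b n) w - poly (Ppoly b n) z * poly (Ppoly b (Suc n)) w"
proof (induction n)
  case (Suc n)
  show ?case
    unfolding sum.lessThan_Suc distrib_left Suc.IH poly_Ppoly_step by (simp add: algebra_simps)
qed simp

text \<open>Finite speed of propagation: a signal from site 0 advances one site per time step. This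
  removes the upper boundary terms in sums over sites.\<close>

lemma dsol_beyond_front: "t < n \<Longrightarrow> dsol b f n t = 0"
  by (induction b f n t rule: dsol.induct) auto

text \<open>Both sides solve \<open>S (t + 2) = z S (t + 1) - S t + f (t + 1)\<close>; on the left this is
  summation by parts, the operator of the system being moved onto the polynomials.\<close>

lemma dsol_Ppoly_sum:
  assumes "t \<le> N"
  shows "(\<Sum>n<N. dsol b f (Suc n) t * poly (Ppoly b (Suc n)) z) =
     (\<Sum>k<t. poly (Tpoly (Suc k)) z * f (t - Suc k))"
  using assms
proof (induction t rule: less_induct)
  case (less t)
  let ?P = "\<lambda>n. poly (Ppoly b n) z" and ?T = "\<lambda>k. poly (Tpoly k) z"
  let ?S = "\<lambda>t. \<Sum>n<N. dsol b f (Suc n) t * ?P (Suc n)"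
  let ?R = "\<lambda>t. \<Sum>k<t. ?T (Suc k) * f (t - Suc k)"
  consider "t = 0" | "t = 1" | s where "t = Suc (Suc s)"
    by (metis One_nat_def not0_implies_Suc)
  then show ?case
  proof cases
    case 1
    then show ?thesis by simp
  next
    case 2
    then obtain M where M: "N = Suc M" using less.prems by (cases N) auto
    \<comment> \<open>At time 1 only site 1 has been reached; its summand is
      \<open>f 0\<close>.\<close>
    have "(\<Sum>n<M. dsol b f (Suc (Suc n)) (Suc 0) * ?P (Suc (Suc n))) = 0"
      using dsol_beyond_front[of "Suc 0" _ b f] by (intro sum.neutral) (simp del: dsol.simps)
    then show ?thesis using 2 unfolding M sum.lessThan_Suc_shift by simp
  next
    case 3
    have N: "s + 2 \<le> N" using less.prems 3 by simp
    have front: "dsol b f N (Suc s) = 0" "dsol b f (Suc N) (Suc s) = 0"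
      using N by (auto intro!: dsol_beyond_front)
    \<comment> \<open>The shift creates a term at 0, zero because P_0 = 0, and drops one at
      \<open>N\<close>, zero because it lies beyond the front.\<close>
    have right: "(\<Sum>n<N. dsol b f (n + 2) (Suc s) * ?P (Suc n)) =
        (\<Sum>n<N. dsol b f (Suc n) (Suc s) * ?P n)"
      using sum.lessThan_Suc_shift[of "\<lambda>n. dsol b f (Suc n) (Suc s) * ?P n" N] front
      by simp
    \<comment> \<open>Here the lower end survives: site 0 carries the control and P_1 = 1, which
      gives the source term.\<close>
    have left: "(\<Sum>n<N. dsol b f n (Suc s) * ?P (Suc n)) =
        f (Suc s) + (\<Sum>n<N. dsol b f (Suc n) (Suc s) * ?P (Suc (Suc n)))"
      using sum.lessThan_Suc_shift[of "\<lambda>n. dsol b f n (Suc s) * ?P (Suc n)" N] front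
      by (simp del: dsol.simps(3,4) Ppoly.simps(3))
    have "?S (Suc (Suc s)) =
        (\<Sum>n<N. dsol b f (n + 2) (Suc s) * ?P (Suc n)) + (\<Sum>n<N. dsol b f n (Suc s) * ?P (Suc n))
        + (\<Sum>n<N. complex_of_real (b (Suc n)) * dsol b f (Suc n) (Suc s) * ?P (Suc n)) - ?S s"
      by (simp add: sum.distrib sum_subtractf algebra_simps)
    also have "\<dots> = f (Suc s) + (\<Sum>n<N. dsol b f (Suc n) (Suc s) *
          (?P n + ?P (Suc (Suc n)) + complex_of_real (b (Suc n)) * ?P (Suc n))) - ?S s"
      unfolding right left by (simp add: sum.distrib algebra_simps del: Ppoly.simps)
    also have "\<dots> = f (Suc s) + z * ?S (Suc s) - ?S s"
    proof -
      have "?P n + ?P (Suc (Suc n)) + complex_of_real (b (Suc n)) * ?P (Suc n) = z * ?P (Suc n)" for n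
        unfolding poly_Ppoly_step by (simp add: algebra_simps)
      then show ?thesis by (simp only: sum_distrib_left mult.left_commute)
    qed
    finally have S: "?S (Suc (Suc s)) = f (Suc s) + z * ?S (Suc s) - ?S s" .
    have "?R (Suc (Suc s)) = f (Suc s) + (\<Sum>k<Suc s. ?T (Suc (Suc k)) * f (s - k))"
      unfolding sum.lessThan_Suc_shift[of _ "Suc s"] by simp
    also have "\<dots> = f (Suc s) + z * ?R (Suc s) - (\<Sum>k<Suc s. ?T k * f (s - k))"
      by (simp add: algebra_simps sum_subtractf sum_distrib_left)
    also have "(\<Sum>k<Suc s. ?T k * f (s - k)) = ?R s"
      unfolding sum.lessThan_Suc_shift by simp
    finally have R: "?R (Suc (Suc s)) = f (Suc s) + z * ?R (Suc s) - ?R s" .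
    show ?thesis
      using less.IH[of s] less.IH[of "Suc s"] N S R unfolding 3 by simp
  qed
qed

section \<open>Coordinates with respect to P_1, ..., P_T\<close>

definition Psum :: "(nat \<Rightarrow> real) \<Rightarrow> nat \<Rightarrow> (nat \<Rightarrow> complex) \<Rightarrow> complex \<Rightarrow> complex" where
  "Psum b T c = (\<lambda>z. \<Sum>n<T. c n * poly (Ppoly b (Suc n)) z)"

lemma Psum_eq_poly: "Psum b T c z = poly (\<Sum>n<T. Polynomial.smult (c n) (Ppoly b (Suc n))) z"
  by (simp add: Psum_def poly_sum)

lemma Tsum_eq_sum: "Tsum T f z = (\<Sum>k<T. poly (Tpoly (Suc k)) z * f $ (T - Suc k))"
  unfolding Tsum_def by (rule sum.reindex_bij_witness[of _ Suc "\<lambda>k. k - 1"]) auto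

text \<open>The summation by parts at time \<open>T\<close> with \<open>N = T\<close>: the final
  state is the coordinate vector of the function in the basis P_1, ..., P_T.\<close>

lemma Tsum_eq_Psum:
  assumes "f \<in> carrier_vec T"
  shows "Tsum T f = Psum b T (\<lambda>n. control_op b T f $ n)"
proof
  fix z
  have "Psum b T (\<lambda>n. control_op b T f $ n) z =
      (\<Sum>n<T. dsol b (\<lambda>k. if k < T then f $ k else 0) (Suc n) T * poly (Ppoly b (Suc n)) z)"
    by (simp add: Psum_def control_op_def)
  also have "\<dots> = (\<Sum>k<T. poly (Tpoly (Suc k)) z * f $ (T - Suc k))"
    unfolding dsol_Ppoly_sum[OF order_refl] by simp
  finally show "Tsum T f z = Psum b T (\<lambda>n. control_op b T f $ n) z"
    by (simp add: Tsum_eq_sum)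
qed

lemma poly_in_BJ:
  assumes "\<And>i. i \<ge> T \<Longrightarrow> coeff p i = 0"
  shows "poly p \<in> BJ T"
proof -
  obtain c where c: "p = (\<Sum>n<T. Polynomial.smult (c n) (Tpoly (Suc n)))"
    using monic_family_span[of "\<lambda>n. Tpoly (Suc n)", OF _ _ assms] Tpoly_degree by blast
  \<comment> \<open>The coefficients are listed backwards because \<open>Tsum\<close> pairs
    \<open>Tpoly k\<close> with the entry \<open>T - k\<close>.\<close>
  have "poly p = Tsum T (Matrix.vec T (\<lambda>k. c (T - Suc k)))"
    unfolding c by (intro ext) (simp add: Tsum_eq_sum poly_sum mult.commute Suc_diff_Suc)
  then show ?thesis by (auto simp: BJ_def)
qed

lemma Psum_in_BJ: "Psum b T c \<in> BJ T"
proof -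
  have "Psum b T c = poly (\<Sum>n<T. Polynomial.smult (c n) (Ppoly b (Suc n)))"
    by (simp add: Psum_eq_poly fun_eq_iff)
  moreover have "poly (\<Sum>n<T. Polynomial.smult (c n) (Ppoly b (Suc n))) \<in> BJ T"
    using Ppoly_monic by (intro poly_in_BJ) (auto simp: coeff_sum intro!: sum.neutral coeff_eq_0)
  ultimately show ?thesis by simp
qed

text \<open>The potential occurs on the right only: the set is the same for every \<open>b\<close>,
  while the scalar product depends on it.\<close>

lemma BJ_eq_range_Psum: "BJ T = range (Psum b T)"
proof
  show "BJ T \<subseteq> range (Psum b T)"
    unfolding BJ_def using Tsum_eq_Psum by blast
qed (use Psum_in_BJ in blast)

lemma BJ_eq_polys: "BJ T = {poly p |p. \<forall>i\<ge>T. coeff p i = 0}"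
proof
  show "BJ T \<subseteq> {poly p |p. \<forall>i\<ge>T. coeff p i = 0}"
  proof
    fix F assume "F \<in> BJ T"
    \<comment> \<open>Any potential would serve; \<open>undefined\<close> stands for an arbitrary
      one.\<close>
    then obtain c where "F = Psum undefined T c"
      unfolding BJ_eq_range_Psum[of T undefined] by auto
    then have "F = poly (\<Sum>n<T. Polynomial.smult (c n) (Ppoly undefined (Suc n)))"
      by (simp add: Psum_eq_poly fun_eq_iff)
    moreover have "\<forall>i\<ge>T. coeff (\<Sum>n<T. Polynomial.smult (c n) (Ppoly undefined (Suc n))) i = 0"
      using Ppoly_monic by (auto simp: coeff_sum intro!: sum.neutral coeff_eq_0)
    ultimately show "F \<in> {poly p |p. \<forall>i\<ge>T. coeff p i = 0}" by blast
  qed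
qed (auto intro: poly_in_BJ)

lemma Psum_inj:
  assumes "Psum b T c = Psum b T d" "n < T"
  shows "c n = d n"
proof -
  have "poly (\<Sum>n<T. Polynomial.smult (c n - d n) (Ppoly b (Suc n))) z = Psum b T c z - Psum b T d z" for z
    by (simp add: Psum_def poly_sum algebra_simps sum_subtractf)
  then have "\<forall>z. poly (\<Sum>n<T. Polynomial.smult (c n - d n) (Ppoly b (Suc n))) z = 0"
    by (simp only: assms(1)) simp
  then have "(\<Sum>n<T. Polynomial.smult (c n - d n) (Ppoly b (Suc n))) = 0"
    unfolding poly_all_0_iff_0 .
  moreover have "degree (Ppoly b (Suc n)) = n" "lead_coeff (Ppoly b (Suc n)) = 1" for n
    using Ppoly_monic by blast+
  ultimately have "c n - d n = 0"
    using assms(2) by (intro monic_family_independent[of "\<lambda>n. Ppoly b (Suc n)"])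
  then show ?thesis by simp
qed

text \<open>The connecting operator turns the scalar product of controls into that of final states,
  and these are the coordinate vectors. So P_1, ..., P_T are orthonormal.\<close>

lemma BJ_inner_Psum: "BJ_inner b T (Psum b T c) (Psum b T d) = (\<Sum>n<T. cnj (c n) * d n)"
proof -
  obtain f g where f: "f \<in> carrier_vec T" "Psum b T c = Tsum T f"
    and g: "g \<in> carrier_vec T" "Psum b T d = Tsum T g"
    using Psum_in_BJ[of b T c] Psum_in_BJ[of b T d] by (auto simp: BJ_def)
  have "c n = control_op b T f $ n" "d n = control_op b T g $ n" if "n < T" for n
    using Psum_inj that f g Tsum_eq_Psum by metis+
  then have "(\<Sum>n<T. cnj (c n) * d n) = cscalar (control_op b T f) (control_op b T g)"
    by (simp add: cscalar_def control_op_def)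
  then show ?thesis
    by (simp add: f g BJ_inner_Tsum connecting_mat_cscalar)
qed

section \<open>Hilbert space structure\<close>

lemma Psum_add: "(\<lambda>z. Psum b T c z + Psum b T d z) = Psum b T (\<lambda>n. c n + d n)"
  by (simp add: Psum_def algebra_simps sum.distrib)

lemma Psum_diff: "(\<lambda>z. Psum b T c z - Psum b T d z) = Psum b T (\<lambda>n. c n - d n)"
  by (simp add: Psum_def algebra_simps sum_subtractf)

lemma Psum_scale: "(\<lambda>z. a * Psum b T c z) = Psum b T (\<lambda>n. a * c n)"
  by (simp add: Psum_def algebra_simps sum_distrib_left)

lemma Psum_0: "Psum b T (\<lambda>n. 0) = (\<lambda>z. 0)"
  by (simp add: Psum_def)

lemma ip_norm_Psum: "ip_norm (BJ_inner b T) (Psum b T c) = L2_set (\<lambda>n. cmod (c n)) {..<T}"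
  by (simp add: ip_norm_def BJ_inner_Psum L2_set_def cmod_power2)
    (simp add: power2_eq_square)

text \<open>The norm dominates each coordinate, so coordinates converge; as there are finitely many,
  the norm of the difference tends to 0.\<close>

lemma BJ_complete:
  assumes X: "\<And>n. X n \<in> BJ T"
    and cauchy: "\<And>e. e > 0 \<Longrightarrow> \<exists>N. \<forall>m\<ge>N. \<forall>n\<ge>N. ip_norm (BJ_inner b T) (\<lambda>z. X m z - X n z) < e"
  shows "\<exists>F\<in>BJ T. (\<lambda>n::nat. ip_norm (BJ_inner b T) (\<lambda>z. X n z - F z)) \<longlonglongrightarrow> 0"
proof -
  have "\<forall>n. \<exists>d. X n = Psum b T d"
    using X unfolding BJ_eq_range_Psum[of T b] by blast
  then obtain c where c: "\<And>n. X n = Psum b T (c n)"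
    unfolding choice_iff by blast
  have "Cauchy (\<lambda>n. c n i)" if i: "i < T" for i
  proof (rule metric_CauchyI)
    fix e :: real assume "e > 0"
    then obtain N where N: "\<forall>m\<ge>N. \<forall>n\<ge>N. ip_norm (BJ_inner b T) (\<lambda>z. X m z - X n z) < e"
      using cauchy by blast
    have "dist (c m i) (c n i) < e" if "m \<ge> N" "n \<ge> N" for m n
    proof -
      have "dist (c m i) (c n i) \<le> L2_set (\<lambda>i. cmod (c m i - c n i)) {..<T}"
        using member_le_L2_set[of "{..<T}" i "\<lambda>i. cmod (c m i - c n i)"] i
        by (simp add: dist_norm)
      also have "\<dots> < e"
        using N that by (simp add: c Psum_diff ip_norm_Psum)
      finally show ?thesis .
    qed
    then show "\<exists>M. \<forall>m\<ge>M. \<forall>n\<ge>M. dist (c m i) (c n i) < e" by blast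
  qed
  then have "\<forall>i. \<exists>l. i < T \<longrightarrow> (\<lambda>n. c n i) \<longlonglongrightarrow> l"
    unfolding Cauchy_convergent_iff convergent_def by blast
  then obtain l where l: "\<And>i. i < T \<Longrightarrow> (\<lambda>n. c n i) \<longlonglongrightarrow> l i"
    unfolding choice_iff by blast
  have "(\<lambda>n. L2_set (\<lambda>i. cmod (c n i - l i)) {..<T}) \<longlonglongrightarrow> L2_set (\<lambda>i. cmod (l i - l i)) {..<T}"
    unfolding L2_set_def by (intro tendsto_intros l) auto
  then have "(\<lambda>n. ip_norm (BJ_inner b T) (\<lambda>z. X n z - Psum b T l z)) \<longlonglongrightarrow> 0"
    by (simp add: c Psum_diff ip_norm_Psum L2_set_def)
  then show ?thesis using Psum_in_BJ by blast
qed

lemma BJ_hilbert: "hilbert_function_space (BJ T) (BJ_inner b T)"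
proof -
  have V: "F \<in> BJ T \<longleftrightarrow> (\<exists>c. F = Psum b T c)" for F
    using BJ_eq_range_Psum by blast
  have pos: "F = (\<lambda>z. 0)" if "F \<in> BJ T" "BJ_inner b T F F = 0" for F
  proof -
    obtain c where c: "F = Psum b T c" using \<open>F \<in> BJ T\<close> V by blast
    have "(\<Sum>n<T. complex_of_real ((cmod (c n))\<^sup>2)) = 0"
      using that(2) unfolding c BJ_inner_Psum by (simp only: complex_norm_square) (simp add: mult.commute)
    then have "(\<Sum>n<T. (cmod (c n))\<^sup>2) = 0"
      by (metis of_real_eq_0_iff of_real_sum)
    then have "c n = 0" if "n < T" for n
      using that by (subst (asm) sum_nonneg_eq_0_iff) auto
    then show ?thesis by (simp add: c Psum_def)
  qed
  have compl: "\<exists>F\<in>BJ T. (\<lambda>n::nat. ip_norm (BJ_inner b T) (\<lambda>z. X n z - F z)) \<longlonglongrightarrow> 0"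
    if "\<forall>n. X n \<in> BJ T" "\<forall>\<epsilon>>0. \<exists>N. \<forall>m\<ge>N. \<forall>n\<ge>N. ip_norm (BJ_inner b T) (\<lambda>z. X m z - X n z) < \<epsilon>" for X
    using BJ_complete that by blast
  have "(\<lambda>z. 0) \<in> BJ T" using Psum_0 V by metis
  moreover have "\<forall>F\<in>BJ T. \<forall>G\<in>BJ T. (\<lambda>z. F z + G z) \<in> BJ T"
    by (auto simp: BJ_eq_range_Psum[of T b] Psum_add)
  moreover have "\<forall>c. \<forall>F\<in>BJ T. (\<lambda>z. c * F z) \<in> BJ T"
    by (auto simp: BJ_eq_range_Psum[of T b] Psum_scale)
  moreover have "\<forall>F\<in>BJ T. \<forall>G\<in>BJ T. \<forall>H\<in>BJ T.
      BJ_inner b T F (\<lambda>z. G z + H z) = BJ_inner b T F G + BJ_inner b T F H"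
    by (auto simp: V Psum_add BJ_inner_Psum algebra_simps sum.distrib)
  moreover have "\<forall>c. \<forall>F\<in>BJ T. \<forall>G\<in>BJ T. BJ_inner b T F (\<lambda>z. c * G z) = c * BJ_inner b T F G"
    by (auto simp: V Psum_scale BJ_inner_Psum algebra_simps sum_distrib_left)
  moreover have "\<forall>F\<in>BJ T. \<forall>G\<in>BJ T. BJ_inner b T G F = cnj (BJ_inner b T F G)"
    by (auto simp: V BJ_inner_Psum mult.commute)
  moreover have "\<forall>F\<in>BJ T. Im (BJ_inner b T F F) = 0 \<and> Re (BJ_inner b T F F) \<ge> 0"
    by (auto simp: V BJ_inner_Psum intro!: sum_nonneg add_nonneg_nonneg)
  ultimately show ?thesis
    unfolding hilbert_function_space_def using pos compl by (intro conjI) blast+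
qed

section \<open>Reproducing kernel\<close>

text \<open>The right side of the kernel equation is the vector whose scalar product with a control
  \<open>f\<close> is \<open>Tsum T f z\<close>. Testing with unit vectors gives the equation
  back.\<close>

lemma kernel_control_iff:
  "kernel_control b T z j \<longleftrightarrow>
     j \<in> carrier_vec T \<and> (\<forall>f\<in>carrier_vec T. BJ_inner b T (Tsum T j) (Tsum T f) = Tsum T f z)"
proof -
  let ?v = "Matrix.vec T (\<lambda>i. cnj (poly (Tpoly (T - i)) z))"
  have v: "cscalar ?v f = Tsum T f z" if "f \<in> carrier_vec T" for f
    using that unfolding Tsum_eq_sum cscalar_def
    by (intro sum.reindex_bij_witness[of _ "\<lambda>k. T - Suc k" "\<lambda>k. T - Suc k"])
       (auto simp: Suc_diff_Suc)
  have C: "connecting_mat b T *\<^sub>v j \<in> carrier_vec T" for j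
    by (auto simp: connecting_mat_def control_mat_def mat_adjoint_def intro!: carrier_vecI)
  have entry: "x $ k = cnj (cscalar x (unit_vec T k))" if "k < T" "x \<in> carrier_vec T" for x k
  proof -
    have "cscalar x (unit_vec T k) = (\<Sum>i<T. cnj (x $ i) * (if i = k then 1 else 0))"
      using that by (auto simp: cscalar_def unit_vec_def intro!: sum.cong)
    also have "\<dots> = cnj (x $ k)"
      using that by (simp add: if_distrib cong: if_cong)
    finally show ?thesis by simp
  qed
  have "connecting_mat b T *\<^sub>v j = ?v"
    if "j \<in> carrier_vec T" and
      "\<forall>f\<in>carrier_vec T. BJ_inner b T (Tsum T j) (Tsum T f) = Tsum T f z"
  proof (rule eq_vecI)
    fix k assume "k < dim_vec ?v"
    then have k: "k < T" by simp
    have "cscalar (connecting_mat b T *\<^sub>v j) (unit_vec T k) = cscalar ?v (unit_vec T k)"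
      using that by (simp add: v BJ_inner_Tsum)
    then show "(connecting_mat b T *\<^sub>v j) $ k = ?v $ k"
      using entry[OF k C] entry[OF k, of ?v] by simp
  next
    show "dim_vec (connecting_mat b T *\<^sub>v j) = dim_vec ?v"
      using C[of j] by (metis carrier_vecD dim_vec)
  qed
  then show ?thesis
    unfolding kernel_control_def using v by (auto simp: BJ_inner_Tsum)
qed

lemma reproducing_Tsum_iff:
  "j \<in> carrier_vec T \<Longrightarrow>
     reproducing_at (BJ T) (BJ_inner b T) z (Tsum T j) \<longleftrightarrow> kernel_control b T z j"
  unfolding reproducing_at_def kernel_control_iff BJ_def by blast

text \<open>In an orthonormal basis the kernel at \<open>z\<close> has the conjugated values of the
  basis functions at \<open>z\<close> as coordinates.\<close>

lemma reproducing_kernel_Psum: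
  "reproducing_at (BJ T) (BJ_inner b T) z (Psum b T (\<lambda>n. cnj (poly (Ppoly b (Suc n)) z)))"
  unfolding reproducing_at_def using Psum_in_BJ
  by (auto simp: BJ_eq_range_Psum[of T b] BJ_inner_Psum)
    (simp add: Psum_def mult.commute)

lemma reproducing_unique:
  assumes "reproducing_at (BJ T) (BJ_inner b T) z K"
  shows "K = Psum b T (\<lambda>n. cnj (poly (Ppoly b (Suc n)) z))"
proof -
  obtain c where c: "K = Psum b T c"
    using assms BJ_eq_range_Psum[of T b] by (auto simp: reproducing_at_def)
  have "c n = cnj (poly (Ppoly b (Suc n)) z)" if n: "n < T" for n
  proof -
    \<comment> \<open>Testing \<open>K\<close> against the basis element
      \<open>Ppoly b (Suc n)\<close> isolates the coordinate \<open>c n\<close>.\<close>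
    let ?e = "\<lambda>k. if k = n then 1 else 0 :: complex"
    have "BJ_inner b T K (Psum b T ?e) = Psum b T ?e z"
      using assms Psum_in_BJ by (auto simp: reproducing_at_def)
    moreover have "(\<Sum>k<T. cnj (c k) * ?e k) = cnj (c n)"
      "(\<Sum>k<T. ?e k * poly (Ppoly b (Suc k)) z) = poly (Ppoly b (Suc n)) z"
      using n sum.delta[of "{..<T}" n "\<lambda>k. cnj (c k)"] sum.delta[of "{..<T}" n "\<lambda>k. poly (Ppoly b (Suc k)) z"]
      by (simp_all add: if_distrib if_distribR cong: if_cong)
    moreover have "Psum b T ?e z = (\<Sum>k<T. ?e k * poly (Ppoly b (Suc k)) z)"
      by (simp only: Psum_def)
    ultimately have "cnj (c n) = poly (Ppoly b (Suc n)) z"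
      by (simp only: c BJ_inner_Psum)
    then show ?thesis by (metis complex_cnj_cnj)
  qed
  then show ?thesis by (simp add: c Psum_def)
qed

text \<open>The connecting operator is not inverted explicitly: the kernel lies in the space, so
  some control represents it, and exactly one by \<open>Tsum_inj\<close>.\<close>

lemma kernel_control_unique_existence: "\<exists>!j. kernel_control b T z j"
proof -
  obtain j where j: "j \<in> carrier_vec T" "Psum b T (\<lambda>n. cnj (poly (Ppoly b (Suc n)) z)) = Tsum T j"
    using Psum_in_BJ by (force simp: BJ_def)
  show ?thesis
  proof (rule ex1I[of _ j])
    show "kernel_control b T z j"
      using reproducing_kernel_Psum[of T b z] j by (simp add: reproducing_Tsum_iff)
  next
    fix k assume k: "kernel_control b T z k"
    then have kc: "k \<in> carrier_vec T" by (simp add: kernel_control_def)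
    then have "Tsum T k = Tsum T j"
      using k j reproducing_unique reproducing_Tsum_iff by metis
    then show "k = j" using Tsum_inj kc j by blast
  qed
qed

lemma reproducing_iff_kernel_control:
  assumes "kernel_control b T z j"
  shows "reproducing_at (BJ T) (BJ_inner b T) z K \<longleftrightarrow> K = Tsum T j"
  using assms reproducing_Tsum_iff reproducing_unique by (metis kernel_control_def)

section \<open>Rational functions without poles in a closed set\<close>

text \<open>By the degrees the quotient has a limit at infinity, so it is bounded outside a ball;
  inside, compactness bounds it.\<close>

lemma poly_bound_on_closed:
  fixes p q :: "complex poly"
  assumes S: "closed S" and q: "\<And>z. z \<in> S \<Longrightarrow> poly q z \<noteq> 0" and deg: "degree p \<le> degree q"
  obtains C where "C > 0" "\<And>z. z \<in> S \<Longrightarrow> cmod (poly p z) \<le> C * cmod (poly q z)"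
proof -
  let ?n = "degree q"
  have lim: "((\<lambda>z. poly p z / z ^ ?n) \<longlongrightarrow> (if degree p = ?n then lead_coeff p else 0)) at_infinity"
  proof (cases "degree p = ?n")
    case True
    then show ?thesis using poly_divide_tendsto_aux[of p] by simp
  next
    case False
    define m where "m = ?n - degree p"
    have m: "m > 0" "?n = degree p + m" using deg False by (auto simp: m_def)
    have "((\<lambda>z::complex. inverse (z ^ m)) \<longlongrightarrow> 0) at_infinity"
      using m(1) by (intro filterlim_compose[OF tendsto_inverse_0] filterlim_power_at_infinity) auto
    then have "((\<lambda>z. poly p z / z ^ degree p * inverse (z ^ m)) \<longlongrightarrow> lead_coeff p * 0) at_infinity"
      by (intro tendsto_mult poly_divide_tendsto_aux)
    then show ?thesis using False by (simp add: m(2) power_add divide_inverse mult.assoc)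
  qed
  have 1: "\<exists>l. ((\<lambda>z. poly p z / poly q z) \<longlongrightarrow> l) at_infinity"
  \<comment> \<open>For \<open>q = 0\<close> the set \<open>S\<close> is empty and the quotient is
    constantly 0 by the convention for division.\<close>
  proof (cases "q = 0")
    case True
    then show ?thesis by (auto intro: tendsto_const)
  next
    case False
    then have "((\<lambda>z. (poly p z / z ^ ?n) / (poly q z / z ^ ?n)) \<longlongrightarrow>
        (if degree p = ?n then lead_coeff p else 0) / lead_coeff q) at_infinity"
      by (intro tendsto_divide lim poly_divide_tendsto_aux) auto
    moreover have "\<forall>\<^sub>F z in at_infinity. (poly p z / z ^ ?n) / (poly q z / z ^ ?n) = poly p z / poly q z"
      by (rule eventually_at_infinityI[of 1]) auto
    ultimately show ?thesis by (blast intro: Lim_transform_eventually)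
  qed
  then obtain l where "((\<lambda>z. poly p z / poly q z) \<longlongrightarrow> l) at_infinity" by blast
  then have "\<forall>\<^sub>F z in at_infinity. dist (poly p z / poly q z) l < 1"
    by (rule tendstoD) simp
  then obtain B where B: "\<And>z. norm z \<ge> B \<Longrightarrow> dist (poly p z / poly q z) l < 1"
    unfolding eventually_at_infinity by blast
  have "compact (S \<inter> cball 0 B)" using S by (simp add: closed_Int_compact)
  moreover have "continuous_on (S \<inter> cball 0 B) (\<lambda>z. poly p z / poly q z)"
    using q by (intro continuous_intros) auto
  ultimately have "bounded ((\<lambda>z. poly p z / poly q z) ` (S \<inter> cball 0 B))"
    using compact_continuous_image compact_imp_bounded by blast
  then obtain D where D: "D > 0" "\<And>z. z \<in> S \<inter> cball 0 B \<Longrightarrow> norm (poly p z / poly q z) \<le> D"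
    unfolding bounded_pos by auto
  define C where "C = D + norm l + 1"
  show ?thesis
  proof
    show "C > 0" using D(1) norm_ge_zero[of l] unfolding C_def by linarith
  next
    fix z assume z: "z \<in> S"
    have "norm (poly p z / poly q z) \<le> C"
    proof (cases "norm z \<le> B")
      case True
      then have "norm (poly p z / poly q z) \<le> D" using D(2)[of z] z by simp
      then show ?thesis using norm_ge_zero[of l] unfolding C_def by linarith
    next
      case False
      then have "dist (poly p z / poly q z) l < 1" using B by simp
      then show ?thesis using D(1) norm_triangle_ineq2[of "poly p z / poly q z" l]
        unfolding C_def dist_norm by linarith
    qed
    then show "cmod (poly p z) \<le> C * cmod (poly q z)"
      using q[OF z] by (simp add: norm_divide divide_simps)
  qed
qed

lemma norm_plus_i_ge: "Im z \<ge> 0 \<Longrightarrow> 1 + (cmod z)\<^sup>2 \<le> (cmod (z + \<i>))\<^sup>2"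
  unfolding cmod_power2 by (simp add: power2_eq_square algebra_simps)

text \<open>Multiplying \<open>p\<close> by \<open>(z + \<i>) ^ k\<close> keeps its degree at most
  that of \<open>q\<close>, and in the upper half-plane this factor dominates the wanted weight.
  Squares keep the exponent integral: \<open>k = 1\<close> serves the Hardy norm,
  \<open>k = 2\<close> integrability.\<close>

lemma poly_quotient_decay:
  fixes p q :: "complex poly"
  assumes S: "closed S" "\<And>z. z \<in> S \<Longrightarrow> Im z \<ge> 0"
    and q: "\<And>z. z \<in> S \<Longrightarrow> poly q z \<noteq> 0" and deg: "degree p + k \<le> degree q"
  obtains C where "C > 0"
    "\<And>z. z \<in> S \<Longrightarrow> (cmod (poly p z / poly q z))\<^sup>2 \<le> C / (1 + (cmod z)\<^sup>2) ^ k"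
proof -
  let ?p = "p * [:\<i>, 1:] ^ k"
  have "degree ?p \<le> degree q"
    using deg degree_mult_le[of p "[:\<i>, 1:] ^ k"] by (simp add: degree_linear_power)
  then obtain C where C: "C > 0" "\<And>z. z \<in> S \<Longrightarrow> cmod (poly ?p z) \<le> C * cmod (poly q z)"
    using poly_bound_on_closed[OF S(1) q, of ?p] by metis
  show ?thesis
  proof
    show "C\<^sup>2 > 0" using C by simp
  next
    fix z assume z: "z \<in> S"
    have "cmod (poly p z) * cmod (z + \<i>) ^ k \<le> C * cmod (poly q z)"
      using C(2)[OF z] by (simp add: norm_mult norm_power add.commute)
    then have "(cmod (poly p z) * cmod (z + \<i>) ^ k)\<^sup>2 \<le> (C * cmod (poly q z))\<^sup>2"
      by (intro power_mono) auto
    then have *: "(cmod (poly p z))\<^sup>2 * ((cmod (z + \<i>))\<^sup>2) ^ k \<le> C\<^sup>2 * (cmod (poly q z))\<^sup>2"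
      by (simp add: power_mult_distrib power_mult[symmetric] mult.commute)
    have "(cmod (poly p z))\<^sup>2 * (1 + (cmod z)\<^sup>2) ^ k \<le> (cmod (poly p z))\<^sup>2 * ((cmod (z + \<i>))\<^sup>2) ^ k"
      by (intro mult_left_mono power_mono norm_plus_i_ge S z) auto
    with * have "(cmod (poly p z))\<^sup>2 * (1 + (cmod z)\<^sup>2) ^ k \<le> C\<^sup>2 * (cmod (poly q z))\<^sup>2" by linarith
    moreover have "(1 + (cmod z)\<^sup>2) ^ k > 0"
      by (intro zero_less_power add_pos_nonneg) auto
    ultimately show "(cmod (poly p z / poly q z))\<^sup>2 \<le> C\<^sup>2 / (1 + (cmod z)\<^sup>2) ^ k"
      using q[OF z] by (simp add: norm_divide power_divide divide_simps mult.commute)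
  qed
qed

lemma integrable_lborel_inverse_1_plus_square: "integrable lborel (\<lambda>x::real. inverse (1 + x\<^sup>2))"
  using integrable_inverse_1_plus_square by (simp add: set_integrable_def)

lemma integral_lborel_inverse_1_plus_square: "(\<integral>x. inverse (1 + x\<^sup>2) \<partial>lborel) = pi"
  using LBINT_inverse_1_plus_square
  by (simp add: interval_lebesgue_integral_def set_lebesgue_integral_def)

text \<open>Quadratic decay on the real line, taken as the closed set; zeros of \<open>q\<close> off
  the line do no harm.\<close>

lemma integrable_poly_quotient:
  fixes p q :: "complex poly"
  assumes q: "\<And>x::real. poly q (of_real x) \<noteq> 0" and deg: "degree p + 2 \<le> degree q"
  shows "integrable lborel (\<lambda>x::real. poly p (of_real x) / poly q (of_real x))"
proof -
  have "Im z \<ge> 0" "poly q z \<noteq> 0" if "z \<in> \<real>" for z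
    using that q by (auto elim!: Reals_cases)
  then obtain C where C: "C > 0"
    "\<And>z. z \<in> \<real> \<Longrightarrow> (cmod (poly p z / poly q z))\<^sup>2 \<le> C / (1 + (cmod z)\<^sup>2) ^ 2"
    using poly_quotient_decay[of \<real> q p 2, OF closed_complex_Reals _ _ deg] by metis
  show ?thesis
  proof (rule Bochner_Integration.integrable_bound)
    show "integrable lborel (\<lambda>x::real. sqrt C * inverse (1 + x\<^sup>2))"
      using integrable_lborel_inverse_1_plus_square by simp
    have "(\<lambda>x::real. poly p (of_real x) / poly q (of_real x)) \<in> borel_measurable borel"
      using q by (intro borel_measurable_continuous_onI continuous_intros) auto
    then show "(\<lambda>x::real. poly p (of_real x) / poly q (of_real x)) \<in> borel_measurable lborel"
      by simp
    show "AE x in lborel. norm (poly p (of_real x) / poly q (of_real x))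
        \<le> norm (sqrt C * inverse (1 + x\<^sup>2))"
    proof (rule AE_I2)
      fix x :: real
      have "sqrt ((cmod (poly p (of_real x) / poly q (of_real x)))\<^sup>2) \<le> sqrt (C / (1 + x\<^sup>2)\<^sup>2)"
        using C(2)[of "of_real x"] by (intro real_sqrt_le_mono) simp
      also have "sqrt (C / (1 + x\<^sup>2)\<^sup>2) = sqrt C * inverse (1 + x\<^sup>2)"
        by (simp add: real_sqrt_divide) (simp add: divide_inverse)
      finally show "norm (poly p (of_real x) / poly q (of_real x)) \<le> norm (sqrt C * inverse (1 + x\<^sup>2))"
        using C(1) by simp
    qed
  qed
qed

text \<open>Cauchy's theorem on a half-disc of radius \<open>r\<close>: the integrand is of order
  \<open>1 / r^2\<close> on the arc, whose length is of order \<open>r\<close>, so the segment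
  integral tends to 0.\<close>

lemma integral_poly_quotient_eq_0:
  fixes p q :: "complex poly"
  assumes q: "\<And>z. Im z \<ge> 0 \<Longrightarrow> poly q z \<noteq> 0" and deg: "degree p + 2 \<le> degree q"
  shows "(\<integral>x. poly p (complex_of_real x) / poly q (of_real x) \<partial>lborel) = 0"
proof -
  define h where "h = (\<lambda>z. poly p z / poly q z)"
  let ?H = "{z. Im z \<ge> 0}"
  have H: "closed ?H" "convex ?H" by (auto intro: closed_halfspace_Im_ge convex_halfspace_Im_ge)
  have int: "integrable lborel (\<lambda>x::real. h (of_real x))"
    unfolding h_def using q deg by (intro integrable_poly_quotient) auto
  obtain C where C: "C > 0" "\<And>z. Im z \<ge> 0 \<Longrightarrow> (cmod (h z))\<^sup>2 \<le> C / (1 + (cmod z)\<^sup>2) ^ 2"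
    using poly_quotient_decay[of ?H q p 2, OF H(1) _ _ deg] q unfolding h_def
    by (metis mem_Collect_eq)
  have holo: "h holomorphic_on ?H"
    unfolding h_def using q by (intro holomorphic_intros) auto
  have bound: "cmod (\<integral>x. indicator {-r..r} x *\<^sub>R h (of_real x) \<partial>lborel) \<le> sqrt C * pi * inverse r"
    if r: "r > 0" for r :: real
  proof -
    let ?L = "linepath (-of_real r) (of_real r) :: real \<Rightarrow> complex"
    let ?A = "part_circlepath 0 r 0 pi"
    have A: "z \<in> ?H" if "z \<in> path_image ?A" for z
      using that r by (auto simp: path_image_part_circlepath' closed_segment_eq_real_ivl
          intro!: mult_nonneg_nonneg sin_ge_zero)
    have L: "path_image ?L \<subseteq> ?H"
      using closed_segment_subset[OF _ _ H(2), of "-of_real r" "of_real r"] by simp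
    have cont: "continuous_on ?H h" using holo holomorphic_on_imp_continuous_on by blast
    have iL: "h contour_integrable_on ?L"
      using cont L by (intro contour_integrable_continuous_linepath) (auto elim: continuous_on_subset)
    have iA: "h contour_integrable_on ?A"
      using cont A by (intro contour_integrable_continuous_part_circlepath continuous_on_subset[OF cont]) auto
    have ends: "pathfinish ?L = pathstart ?A" "pathfinish ?A = pathstart ?L"
      by (simp_all add: exp_Euler)
    \<comment> \<open>The closed contour lies in the closed half-plane, which is convex and free of
      poles.\<close>
    have "(h has_contour_integral 0) (?L +++ ?A)"
      using L A ends by (intro Cauchy_theorem_convex_simple[OF holo H(2)] valid_path_join)
        (auto simp: path_image_join)
    then have "contour_integral ?L h + contour_integral ?A h = 0"
      using contour_integral_unique contour_integral_join[OF iL iA] by fastforce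
    then have eq: "cmod (contour_integral ?L h) = cmod (contour_integral ?A h)"
      by (metis add_eq_0_iff norm_minus_cancel)
    have "cmod (contour_integral ?A h) \<le> (sqrt C / r\<^sup>2) * r * \<bar>pi - 0\<bar>"
    proof (rule contour_integral_bound_part_circlepath[OF iA])
      fix z assume z: "z \<in> path_image ?A"
      have "cmod z = r"
        using in_path_image_part_circlepath[OF z] r by simp
      then have "sqrt ((cmod (h z))\<^sup>2) \<le> sqrt (C / (1 + r\<^sup>2)\<^sup>2)"
        using C(2)[of z] A[OF z] by (intro real_sqrt_le_mono) simp
      also have "\<dots> \<le> sqrt C / r\<^sup>2"
        using C(1) r by (simp add: real_sqrt_divide frac_le)
      finally show "cmod (h z) \<le> sqrt C / r\<^sup>2" by simp
    qed (use C r in auto)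
    moreover have "contour_integral ?L h = integral {-r..r} (\<lambda>x. h (of_real x))"
      using r by (subst contour_integral_linepath_Reals_eq) auto
    moreover have "set_integrable lborel {-r..r} (\<lambda>x. h (of_real x))"
      using int unfolding set_integrable_def by (intro integrable_mult_indicator) auto
    then have "(\<integral>x. indicator {-r..r} x *\<^sub>R h (of_real x) \<partial>lborel) = integral {-r..r} (\<lambda>x. h (of_real x))"
      using set_borel_integral_eq_integral(2) by (fastforce simp: set_lebesgue_integral_def)
    ultimately show ?thesis
      using eq r by (simp add: power2_eq_square field_simps)
  qed
  \<comment> \<open>\<open>Suc n\<close> keeps the radius positive, as \<open>bound\<close>
    demands.\<close>
  have "(\<lambda>n. \<integral>x. indicator {-real (Suc n)..real (Suc n)} x *\<^sub>R h (of_real x) \<partial>lborel)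
      \<longlonglongrightarrow> (\<integral>x. h (complex_of_real x) \<partial>lborel)"
  proof (rule integral_dominated_convergence[where w = "\<lambda>x. cmod (h (of_real x))"])
    show "AE x in lborel. (\<lambda>n. indicator {-real (Suc n)..real (Suc n)} x *\<^sub>R h (complex_of_real x))
        \<longlonglongrightarrow> h (of_real x)"
    proof (rule AE_I2)
      fix x :: real
      obtain N where N: "\<bar>x\<bar> \<le> real N" using real_arch_simple by blast
      have "\<forall>\<^sub>F n in sequentially. indicator {-real (Suc n)..real (Suc n)} x *\<^sub>R h (of_real x) = h (complex_of_real x)"
        using eventually_ge_at_top[of N] by eventually_elim (use N in \<open>auto simp: indicator_def\<close>)
      then show "(\<lambda>n. indicator {-real (Suc n)..real (Suc n)} x *\<^sub>R h (complex_of_real x)) \<longlonglongrightarrow> h (of_real x)"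
        by (rule tendsto_eventually)
    qed
  qed (use int in \<open>auto simp: indicator_def\<close>)
  moreover have "(\<lambda>n. \<integral>x. indicator {-real (Suc n)..real (Suc n)} x *\<^sub>R h (of_real x) \<partial>lborel) \<longlonglongrightarrow> 0"
  proof (rule Lim_null_comparison)
    show "\<forall>\<^sub>F n in sequentially. norm (\<integral>x. indicator {-real (Suc n)..real (Suc n)} x *\<^sub>R h (of_real x) \<partial>lborel)
        \<le> sqrt C * pi * inverse (real (Suc n))"
      by (intro always_eventually allI bound) simp
    show "(\<lambda>n. sqrt C * pi * inverse (real (Suc n))) \<longlonglongrightarrow> 0"
      by (intro tendsto_mult_right_zero LIMSEQ_inverse_real_of_nat)
  qed
  ultimately have "(\<integral>x. h (complex_of_real x) \<partial>lborel) = 0"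
    by (rule LIMSEQ_unique)
  then show ?thesis by (simp add: h_def)
qed

section \<open>Hardy space bounds and polynomial growth\<close>

text \<open>Carries the Hardy bound, stated with the nonnegative Lebesgue integral, over to the
  gauge integral of the fundamental theorem of calculus.\<close>

lemma integral_le_of_nn_integral:
  fixes g :: "real \<Rightarrow> real"
  assumes "continuous_on {a..b} g" "\<And>x. g x \<ge> 0" "(\<integral>\<^sup>+x. ennreal (g x) \<partial>lborel) \<le> ennreal M" "M \<ge> 0"
  shows "integral {a..b} g \<le> M"
proof -
  have "(g has_integral integral {a..b} g) {a..b}"
    using assms(1) integrable_continuous_interval by blast
  then have "ennreal (integral {a..b} g) = (\<integral>\<^sup>+x. ennreal (g x) * indicator {a..b} x \<partial>lborel)"
    using nn_integral_has_integral_lebesgue' assms(2) by metis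
  also have "\<dots> \<le> (\<integral>\<^sup>+x. ennreal (g x) \<partial>lborel)"
    by (intro nn_integral_mono) (auto simp: indicator_def)
  also have "\<dots> \<le> ennreal M" by (rule assms(3))
  finally show ?thesis using assms(4) ennreal_le_iff by blast
qed

text \<open>Averaging over a horizontal segment of length \<open>h \<le> y\<close> controls the increment \<open>P (w + h) - P w\<close> of
  a primitive \<open>P\<close> of \<open>f\<close> uniformly in \<open>w\<close>; by Cauchy's estimate so is its derivative
  \<open>f (w + h) - f w\<close>, and a second averaging then controls \<open>f\<close> itself.\<close>

lemma hardy_H2_pointwise:
  assumes "f \<in> hardy_H2"
  obtains C where "C \<ge> 0" "\<And>z. Im z > 0 \<Longrightarrow> cmod (f z) \<le> C / sqrt (Im z)"
proof -
  let ?U = "{z. Im z > 0}"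
  have U: "open ?U" "convex ?U" by (auto intro: open_halfspace_Im_gt convex_halfspace_Im_gt)
  have holo: "f holomorphic_on ?U"
    and sup: "(SUP y\<in>{0<..}. \<integral>\<^sup>+x. ennreal ((cmod (f (Complex x y)))\<^sup>2) \<partial>lborel) < \<infinity>"
    using assms by (auto simp: hardy_H2_def)
  define M where "M = enn2real (SUP y\<in>{0<..}. \<integral>\<^sup>+x. ennreal ((cmod (f (Complex x y)))\<^sup>2) \<partial>lborel)"
  have M0: "M \<ge> 0" by (simp add: M_def)
  have M: "(\<integral>\<^sup>+x. ennreal ((cmod (f (Complex x y)))\<^sup>2) \<partial>lborel) \<le> ennreal M" if "y > 0" for y
    using sup that unfolding M_def by (subst ennreal_enn2real) (auto intro: SUP_upper)
  have cf: "continuous_on S (\<lambda>x. f (Complex x y))" if "y > 0" for y S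
  proof -
    have "continuous_on S (f \<circ> (\<lambda>x. of_real x + \<i> * of_real y))"
      using that by (intro continuous_on_compose continuous_intros
          continuous_on_subset[OF holomorphic_on_imp_continuous_on[OF holo]]) auto
    then show ?thesis by (simp add: o_def Complex_eq)
  qed
  have I: "integral {a..b} (\<lambda>x. (cmod (f (Complex x y)))\<^sup>2) \<le> M" if "y > 0" for a b y
    using M0 M that cf by (intro integral_le_of_nn_integral) (auto intro!: continuous_intros)
  obtain P where P: "\<And>z. z \<in> ?U \<Longrightarrow> (P has_field_derivative f z) (at z within ?U)"
    using holomorphic_convex_primitive'[OF U(2,1) holo] by blast
  then have P': "(P has_field_derivative f z) (at z)" if "Im z > 0" for z
    using that U(1) at_within_open[of z ?U] by (metis mem_Collect_eq)
  \<comment> \<open>The elementary inequality \<open>c \<le> e + c^2 / e\<close> replaces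
    Cauchy-Schwarz; the weight \<open>e\<close> is chosen later.\<close>
  have incr: "cmod (P (Complex b y) - P (Complex a y)) \<le> e * (b - a) + M / e"
    if "a \<le> b" "y > 0" "e > 0" for a b y e
  proof -
    have "((\<lambda>x. f (Complex x y)) has_integral (P (Complex b y) - P (Complex a y))) {a..b}"
    proof (rule fundamental_theorem_of_calculus[OF \<open>a \<le> b\<close>])
      fix x :: real
      have "((\<lambda>z. P (z + \<i> * of_real y)) has_field_derivative f (of_real x + \<i> * of_real y)) (at (of_real x))"
        using P'[of "of_real x + \<i> * of_real y"] \<open>y > 0\<close> by (simp add: DERIV_shift)
      from has_vector_derivative_real_field[OF this]
      show "((\<lambda>x. P (Complex x y)) has_vector_derivative f (Complex x y)) (at x within {a..b})"
        by (simp add: Complex_eq)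
    qed
    then have "P (Complex b y) - P (Complex a y) = integral {a..b} (\<lambda>x. f (Complex x y))"
      by (simp add: integral_unique)
    moreover have "norm (integral {a..b} (\<lambda>x. f (Complex x y))) \<le>
        integral {a..b} (\<lambda>x. e + (cmod (f (Complex x y)))\<^sup>2 / e)"
    proof (rule integral_norm_bound_integral)
      fix x
      let ?c = "cmod (f (Complex x y))"
      have "?c * e \<le> e\<^sup>2 + ?c\<^sup>2"
        using sum_squares_bound[of ?c e] zero_le_power2[of ?c] zero_le_power2[of e] by linarith
      then show "?c \<le> e + ?c\<^sup>2 / e"
        using \<open>e > 0\<close> by (simp add: field_simps power2_eq_square)
    qed (use cf that in \<open>auto intro!: integrable_continuous_interval continuous_intros\<close>)
    moreover have "integral {a..b} (\<lambda>x. e + (cmod (f (Complex x y)))\<^sup>2 / e) =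
        e * (b - a) + integral {a..b} (\<lambda>x. (cmod (f (Complex x y)))\<^sup>2) / e"
      using cf that by (subst Henstock_Kurzweil_Integration.integral_add)
        (auto intro!: integrable_continuous_interval continuous_intros)
    moreover have "\<dots> \<le> e * (b - a) + M / e"
      using I[OF \<open>y > 0\<close>] \<open>e > 0\<close> by (simp add: divide_right_mono)
    ultimately show ?thesis by simp
  qed
  \<comment> \<open>This comes from Cauchy's estimate on a circle of radius \<open>y / 2\<close>
    with the bound \<open>2 * (1 + M) * sqrt y\<close> for the increment.\<close>
  define K where "K = 4 * (1 + M)"
  have K0: "K \<ge> 0" using M0 by (simp add: K_def)
  have osc: "cmod (f (z + of_real h) - f z) \<le> K / sqrt (Im z)" if z: "Im z > 0" and h: "0 \<le> h" "h \<le> Im z" for z h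
  proof -
    define y where "y = Im z"
    define D where "D = (\<lambda>w. P (w + of_real h) - P w)"
    have y: "y > 0" using z by (simp add: y_def)
    have D': "(D has_field_derivative f (w + of_real h) - f w) (at w)" if "Im w > 0" for w
      unfolding D_def using P'[of w] P'[of "w + of_real h"] that
      by (intro DERIV_diff) (simp_all add: DERIV_shift)
    have sub: "Im w > 0" if "w \<in> cball z (y / 2)" for w
    proof -
      have "\<bar>Im (z - w)\<bar> \<le> y / 2"
        using that abs_Im_le_cmod[of "z - w"] by (simp add: dist_norm)
      then show ?thesis using y unfolding y_def minus_complex.sel by arith
    qed
    have "D holomorphic_on ?U"
      using D' U(1) by (auto simp: holomorphic_on_open)
    then have "D holomorphic_on cball z (y / 2)"
      using sub by (auto intro: holomorphic_on_subset)
    then have Dh: "D holomorphic_on ball z (y / 2)" "continuous_on (cball z (y / 2)) D"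
      by (auto intro: holomorphic_on_imp_continuous_on holomorphic_on_subset)
    have "cmod ((deriv ^^ 1) D z) \<le> fact 1 * (2 * (1 + M) * sqrt y) / (y / 2) ^ 1"
    proof (rule Cauchy_inequality[OF Dh])
      fix w assume w: "cmod (z - w) = y / 2"
      then have w0: "Im w > 0" using sub by (simp add: dist_norm)
      have "cmod (D w) = cmod (P (Complex (Re w + h) (Im w)) - P (Complex (Re w) (Im w)))"
      proof -
        have "w + of_real h = Complex (Re w + h) (Im w)" by (simp add: complex_eq_iff)
        then show ?thesis by (simp add: D_def)
      qed
      \<comment> \<open>The choice \<open>e = 1 / sqrt y\<close> makes both terms of order
        \<open>sqrt y\<close>, since \<open>h \<le> y\<close>.\<close>
      also have "\<dots> \<le> (1 / sqrt y) * (Re w + h - Re w) + M / (1 / sqrt y)"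
        using h w0 y by (intro incr) auto
      also have "\<dots> = h / sqrt y + M * sqrt y" by simp
      also have "h / sqrt y \<le> y / sqrt y" using h y by (intro divide_right_mono) (auto simp: y_def)
      also have "y / sqrt y = sqrt y" using y by (simp add: real_div_sqrt)
      finally have "cmod (D w) \<le> (1 + M) * sqrt y" by (simp add: algebra_simps)
      moreover have "(1 + M) * sqrt y \<ge> 0" using M0 y by simp
      ultimately show "cmod (D w) \<le> 2 * (1 + M) * sqrt y" by linarith
    qed (use y in auto)
    moreover have "deriv D z = f (z + of_real h) - f z" using D'[OF z] DERIV_imp_deriv by blast
    ultimately have "cmod (f (z + of_real h) - f z) \<le> 4 * (1 + M) * (sqrt y / y)"
      by (simp add: algebra_simps add_divide_distrib)
    also have "sqrt y / y = 1 / sqrt y" using y by (simp add: real_div_sqrt field_simps)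
    finally show ?thesis by (simp add: K_def y_def)
  qed
  \<comment> \<open>Integrating \<open>2 * |f|^2 + 2 * K^2 / y\<close> over a segment of length
    \<open>y\<close> yields \<open>2 * M + 2 * K^2\<close>.\<close>
  define C where "C = sqrt (2 * M + 2 * K\<^sup>2)"
  show ?thesis
  proof
    show "C \<ge> 0" using M0 by (simp add: C_def)
  next
    fix z :: complex assume z: "Im z > 0"
    define x y where "x = Re z" and "y = Im z"
    have z_eq: "z = Complex x y" and y: "y > 0" using z by (auto simp: x_def y_def)
    have "integral {x..x+y} (\<lambda>t. (cmod (f z))\<^sup>2) \<le>
        integral {x..x+y} (\<lambda>t. 2 * (cmod (f (Complex t y)))\<^sup>2 + 2 * K\<^sup>2 / y)"
    proof (rule integral_le)
      fix t assume t: "t \<in> {x..x+y}"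
      have "cmod (f (z + of_real (t - x)) - f z) \<le> K / sqrt y"
        using osc[OF z, of "t - x"] t by (auto simp: y_def)
      moreover have "z + of_real (t - x) = Complex t y" by (simp add: z_eq complex_eq_iff)
      ultimately have "cmod (f z) \<le> cmod (f (Complex t y)) + K / sqrt y"
        using norm_triangle_ineq2[of "f z" "f (Complex t y)"] by (simp add: norm_minus_commute)
      then have "(cmod (f z))\<^sup>2 \<le> (cmod (f (Complex t y)) + K / sqrt y)\<^sup>2"
        by (intro power_mono) auto
      also have "\<dots> \<le> 2 * (cmod (f (Complex t y)))\<^sup>2 + 2 * (K / sqrt y)\<^sup>2"
        using sum_squares_bound[of "cmod (f (Complex t y))" "K / sqrt y"] by (simp add: power2_sum)
      also have "(K / sqrt y)\<^sup>2 = K\<^sup>2 / y" using y by (simp add: power_divide)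
      finally show "(cmod (f z))\<^sup>2 \<le> 2 * (cmod (f (Complex t y)))\<^sup>2 + 2 * K\<^sup>2 / y" by simp
    qed (use cf y in \<open>auto intro!: integrable_continuous_interval continuous_intros\<close>)
    also have "\<dots> = 2 * integral {x..x+y} (\<lambda>t. (cmod (f (Complex t y)))\<^sup>2) + 2 * K\<^sup>2"
      using cf y by (subst Henstock_Kurzweil_Integration.integral_add)
        (auto intro!: integrable_continuous_interval continuous_intros)
    also have "\<dots> \<le> 2 * M + 2 * K\<^sup>2" using I[OF y] by simp
    finally have "y * (cmod (f z))\<^sup>2 \<le> 2 * M + 2 * K\<^sup>2" using y by simp
    then have "(cmod (f z))\<^sup>2 \<le> (2 * M + 2 * K\<^sup>2) / y" using y by (simp add: field_simps)
    then have "sqrt ((cmod (f z))\<^sup>2) \<le> sqrt ((2 * M + 2 * K\<^sup>2) / y)" by (rule real_sqrt_le_mono)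
    then show "cmod (f z) \<le> C / sqrt (Im z)" by (simp add: C_def y_def real_sqrt_divide)
  qed
qed

text \<open>On \<open>|z| = R\<close> one has \<open>z\<^sup>2 - R\<^sup>2 = 2 i z Im z\<close>, so the factor \<open>z\<^sup>2 - R\<^sup>2\<close> cancels the
  singularity of the bound at the real axis, and the maximum principle applies.\<close>

lemma entire_poly_of_growth:
  assumes F: "F holomorphic_on UNIV" and C: "C \<ge> 0"
    and bound: "\<And>z. Im z \<noteq> 0 \<Longrightarrow> cmod (F z) \<le> C * (1 + cmod z) ^ n / sqrt \<bar>Im z\<bar>"
  shows "\<exists>p. F = poly p \<and> (\<forall>i\<ge>n. coeff p i = 0)"
proof -
  \<comment> \<open>On the circle \<open>1 + R \<le> 2 * R\<close> gives \<open>2 ^ n\<close> and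
    the factor \<open>z^2 - R^2\<close> one more 2; the last 2 comes from its lower bound
    \<open>R^2 / 2\<close> at the inner point.\<close>
  define K where "K = C * 2 ^ (n + 2)"
  have K0: "K \<ge> 0" using C by (simp add: K_def)
  have main: "cmod (F z) \<le> K * R ^ n / sqrt R" if R: "R \<ge> 1" "cmod z \<le> R / 2" for R z
  proof -
    define G where "G = (\<lambda>w. F w * (w\<^sup>2 - of_real (R\<^sup>2)))"
    have G: "G holomorphic_on S" for S
      unfolding G_def by (intro holomorphic_intros holomorphic_on_subset[OF F]) auto
    have bd: "cmod (G w) \<le> C * 2 ^ (n + 1) * R ^ n * (R * sqrt R)" if w: "cmod w = R" for w
    proof (cases "Im w = 0")
      case True
      then have "w\<^sup>2 = of_real (R\<^sup>2)"
        using w by (auto simp: complex_eq_iff cmod_def power2_eq_square)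
      then have "G w = 0" by (simp add: G_def)
      then show ?thesis using C R by simp
    next
      case False
      define y where "y = \<bar>Im w\<bar>"
      have y: "y > 0" "y \<le> R" using False abs_Im_le_cmod[of w] w by (auto simp: y_def)
      have "w\<^sup>2 - of_real (R\<^sup>2) = w * (w - cnj w)"
        using complex_norm_square[of w] w by (simp add: power2_eq_square algebra_simps)
      also have "w - cnj w = 2 * \<i> * of_real (Im w)"
        by (simp add: complex_eq_iff)
      finally have "cmod (w\<^sup>2 - of_real (R\<^sup>2)) = R * (2 * y)"
        using w by (simp add: norm_mult y_def)
      then have "cmod (G w) = cmod (F w) * (R * (2 * y))" by (simp add: G_def norm_mult)
      also have "\<dots> \<le> C * (1 + R) ^ n / sqrt y * (R * (2 * y))"
        using bound[OF False] w y R by (intro mult_right_mono) (auto simp: y_def)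
      also have "\<dots> = C * (1 + R) ^ n * 2 * R * (y / sqrt y)" by simp
      also have "y / sqrt y = sqrt y" using y by (simp add: real_div_sqrt)
      also have "C * (1 + R) ^ n * 2 * R * sqrt y \<le> C * (2 * R) ^ n * 2 * R * sqrt R"
        using C R y by (intro mult_mono power_mono) auto
      finally show ?thesis by (simp add: power_mult_distrib mult_ac)
    qed
    have "cmod (G z) \<le> C * 2 ^ (n + 1) * R ^ n * (R * sqrt R)"
    proof (rule maximum_modulus_frontier[of G "cball 0 R"])
      show "continuous_on (closure (cball 0 R)) G"
        using G holomorphic_on_imp_continuous_on by blast
      show "z \<in> cball 0 R" using R by simp
    qed (use G bd R in \<open>auto simp: dist_norm\<close>)
    moreover have "cmod (G z) \<ge> cmod (F z) * (R\<^sup>2 / 2)"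
    proof -
      have "(cmod z)\<^sup>2 \<le> (R / 2)\<^sup>2" using R by (intro power_mono) auto
      then have "R\<^sup>2 / 2 \<le> R\<^sup>2 - (cmod z)\<^sup>2" 
        by (simp add: power_divide) (insert zero_le_power2[of "cmod z"], linarith)
      also have "\<dots> \<le> cmod (z\<^sup>2 - of_real (R\<^sup>2))"
        using norm_triangle_ineq3[of "z\<^sup>2" "of_real (R\<^sup>2)"] by (simp add: norm_power)
      finally show ?thesis unfolding G_def norm_mult by (intro mult_left_mono) auto
    qed
    ultimately have "cmod (F z) * (R\<^sup>2 / 2) \<le> C * 2 ^ (n + 1) * R ^ n * (R * sqrt R)" by linarith
    also have "\<dots> = (K * R ^ n / sqrt R) * (R\<^sup>2 / 2)"
    proof -
      have "sqrt R * sqrt R = R" "sqrt R \<noteq> 0" using R by auto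
      then show ?thesis by (simp add: K_def field_simps power2_eq_square)
    qed
    finally show ?thesis by (rule mult_right_le_imp_le) (use R in auto)
  qed
  define a where "a = (\<lambda>k. (deriv ^^ k) F 0 / fact k)"
  define p where "p = (\<Sum>k\<le>n. monom (a k) k)"
  have "F z = poly p z" for z
  proof -
    have "F z = (\<Sum>k\<le>n. (deriv ^^ k) F 0 / fact k * z ^ k)"
    proof (rule Liouville_polynomial[OF F])
      fix z :: complex assume z: "1 \<le> cmod z"
      have "cmod (F z) \<le> K * (2 * cmod z) ^ n / sqrt (2 * cmod z)"
        using z by (intro main) auto
      also have "\<dots> \<le> K * (2 * cmod z) ^ n / 1"
        using z K0 by (intro divide_left_mono) auto
      finally show "cmod (F z) \<le> (K * 2 ^ n) * cmod z ^ n" by (simp add: power_mult_distrib)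
    qed
    then show ?thesis by (simp add: p_def a_def poly_sum poly_monom)
  qed
  \<comment> \<open>Liouville's theorem leaves degree at most \<open>n\<close>; the spare factor
    \<open>1 / sqrt R\<close> in Cauchy's estimate removes the coefficient of index
    \<open>n\<close>.\<close>
  moreover have "a n = 0"
  proof -
    have "cmod ((deriv ^^ n) F 0) \<le> fact n * (K * 2 ^ n) * inverse (sqrt R)" if R: "R \<ge> 1" for R
    proof -
      have "cmod ((deriv ^^ n) F 0) \<le> fact n * (K * R ^ n / sqrt R) / (R / 2) ^ n"
        using R main[OF R] by (intro Cauchy_inequality holomorphic_on_subset[OF F]
            continuous_on_subset[OF holomorphic_on_imp_continuous_on[OF F]]) auto
      also have "\<dots> = fact n * (K * 2 ^ n) * inverse (sqrt R)"
        using R by (simp add: power_divide field_simps)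
      finally show ?thesis .
    qed
    moreover have "((\<lambda>R. fact n * (K * 2 ^ n) * inverse (sqrt R)) \<longlongrightarrow> 0) at_top"
      by (intro tendsto_mult_right_zero tendsto_inverse_0_at_top sqrt_at_top)
    ultimately have "cmod ((deriv ^^ n) F 0) \<le> 0"
      by (intro tendsto_lowerbound[where F = at_top and f = "\<lambda>R. fact n * (K * 2 ^ n) * inverse (sqrt R)"])
         (auto intro: eventually_mono[OF eventually_ge_at_top[of 1]])
    then show ?thesis by (simp add: a_def)
  qed
  then have "\<forall>i\<ge>n. coeff p i = 0"
    by (auto simp: p_def coeff_sum intro!: sum.neutral)
  ultimately show ?thesis by blast
qed

section \<open>The Hermite-Biehler function\<close>

definition Epoly :: "(nat \<Rightarrow> real) \<Rightarrow> nat \<Rightarrow> complex poly" where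
  "Epoly b T = Ppoly b (Suc T) + Polynomial.smult \<i> (Ppoly b T)"

lemma poly_Epoly: "poly (Epoly b T) z = poly (Ppoly b (Suc T)) z + \<i> * poly (Ppoly b T) z"
  by (simp add: Epoly_def)

lemma Epoly_monic:
  assumes "T \<ge> 1"
  shows "degree (Epoly b T) = T" "lead_coeff (Epoly b T) = 1"
proof -
  obtain m where m: "T = Suc m" using assms by (cases T) auto
  have P: "degree (Ppoly b (Suc m)) = m" "degree (Ppoly b (Suc T)) = T" "coeff (Ppoly b (Suc T)) T = 1"
    using Ppoly_monic[of b m] Ppoly_monic[of b T] by auto
  have small: "degree (Polynomial.smult \<i> (Ppoly b T)) < degree (Ppoly b (Suc T))"
    using P degree_smult_le[of \<i> "Ppoly b T"] unfolding m by linarith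
  show 1: "degree (Epoly b T) = T"
    unfolding Epoly_def by (subst degree_add_eq_left[OF small]) (rule P)
  have "coeff (Ppoly b T) T = 0" using P m by (simp add: coeff_eq_0)
  then show "lead_coeff (Epoly b T) = 1"
    unfolding 1 using P by (simp add: Epoly_def del: Ppoly.simps)
qed

text \<open>Only the mixed terms of the squared norms differ, and these form the Christoffel-Darboux
  expression at \<open>w = cnj z\<close>.\<close>

lemma Epoly_norm_diff:
  "(cmod (poly (Epoly b T) z))\<^sup>2 - (cmod (poly (Epoly b T) (cnj z)))\<^sup>2 =
     4 * Im z * (\<Sum>k<T. (cmod (poly (Ppoly b (Suc k)) z))\<^sup>2)"
proof -
  let ?A = "poly (Ppoly b (Suc T)) z" and ?B = "poly (Ppoly b T) z"
  let ?S = "\<Sum>k<T. (cmod (poly (Ppoly b (Suc k)) z))\<^sup>2"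
  have "(z - cnj z) * (\<Sum>k<T. poly (Ppoly b (Suc k)) z * cnj (poly (Ppoly b (Suc k)) z)) =
      ?A * cnj ?B - ?B * cnj ?A"
    using christoffel_darboux[of z "cnj z" b T] by (simp only: cnj_poly_Ppoly)
  moreover have "z - cnj z = 2 * \<i> * of_real (Im z)" by (simp add: complex_eq_iff)
  moreover have "(\<Sum>k<T. poly (Ppoly b (Suc k)) z * cnj (poly (Ppoly b (Suc k)) z)) = complex_of_real ?S"
    by (simp only: of_real_sum complex_norm_square)
  ultimately have CD: "2 * \<i> * of_real (Im z) * complex_of_real ?S = ?A * cnj ?B - ?B * cnj ?A"
    by simp
  have "complex_of_real ((cmod (?A + \<i> * ?B))\<^sup>2 - (cmod (cnj ?A + \<i> * cnj ?B))\<^sup>2) =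
      - 2 * \<i> * (?A * cnj ?B - ?B * cnj ?A)"
    unfolding of_real_diff complex_norm_square by (simp add: algebra_simps)
  also have "\<dots> = complex_of_real (4 * Im z * ?S)"
    unfolding CD[symmetric] by (simp add: algebra_simps del: of_real_sum)
  finally have "(cmod (?A + \<i> * ?B))\<^sup>2 - (cmod (cnj ?A + \<i> * cnj ?B))\<^sup>2 = 4 * Im z * ?S"
    using of_real_eq_iff by blast
  then show ?thesis unfolding poly_Epoly cnj_poly_Ppoly .
qed

text \<open>The sum in \<open>Epoly_norm_diff\<close> contains P_1 = 1 because
  \<open>T \<ge> 1\<close>, so it is positive.\<close>

lemma hermite_biehler_Epoly:
  assumes "T \<ge> 1"
  shows "hermite_biehler (poly (Epoly b T))"
  unfolding hermite_biehler_def
proof (intro conjI allI impI)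
  show "poly (Epoly b T) holomorphic_on UNIV" by (intro holomorphic_intros)
next
  fix z :: complex assume z: "Im z > 0"
  have "(\<Sum>k<T. (cmod (poly (Ppoly b (Suc k)) z))\<^sup>2) \<ge> (cmod (poly (Ppoly b (Suc 0)) z))\<^sup>2"
    using assms by (intro member_le_sum) auto
  then have "(\<Sum>k<T. (cmod (poly (Ppoly b (Suc k)) z))\<^sup>2) > 0" by simp
  then have "4 * Im z * (\<Sum>k<T. (cmod (poly (Ppoly b (Suc k)) z))\<^sup>2) > 0"
    using z by simp
  then have "(cmod (poly (Epoly b T) (cnj z)))\<^sup>2 < (cmod (poly (Epoly b T) z))\<^sup>2"
    using Epoly_norm_diff[of b T z] by linarith
  then show "cmod (poly (Epoly b T) (cnj z)) < cmod (poly (Epoly b T) z)"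
    by (rule power_less_imp_less_base) simp
qed

text \<open>At a zero of P_(n+1) the recurrence reduces to P_(n+2) = -P_n.\<close>

lemma Ppoly_no_common_root: "poly (Ppoly b n) z \<noteq> 0 \<or> poly (Ppoly b (Suc n)) z \<noteq> 0"
proof (induction n)
  case (Suc n)
  then show ?case using poly_Ppoly_step[of b n z] by (cases "poly (Ppoly b (Suc n)) z = 0") auto
qed simp

lemma cnj_poly_Ppoly_of_real [simp]:
  "cnj (poly (Ppoly b n) (complex_of_real x)) = poly (Ppoly b n) (complex_of_real x)"
  by (simp add: cnj_poly_Ppoly)

text \<open>Above the real line the strict Hermite-Biehler inequality excludes zeros; on it a zero
  would be a common root of the real numbers P_(T+1) and P_T.\<close>

lemma Epoly_nonzero:
  assumes "T \<ge> 1" "Im z \<ge> 0"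
  shows "poly (Epoly b T) z \<noteq> 0"
proof (cases "Im z = 0")
  case True
  then have z: "z = of_real (Re z)" by (simp add: complex_eq_iff)
  define A B where "A = poly (Ppoly b (Suc T)) z" and "B = poly (Ppoly b T) z"
  have real: "cnj A = A" "cnj B = B"
    unfolding A_def B_def by (subst z, subst (2) z, rule cnj_poly_Ppoly_of_real)+
  show ?thesis
  proof
    assume "poly (Epoly b T) z = 0"
    then have "A + \<i> * B = 0" by (simp add: poly_Epoly A_def B_def)
    moreover from this have "cnj (A + \<i> * B) = 0" by simp
    then have "A - \<i> * B = 0" using real by simp
    ultimately have "A = 0" "B = 0" by (auto simp: algebra_simps)
    then show False using Ppoly_no_common_root[of b T z] by (simp add: A_def B_def del: Ppoly.simps)
  qed
next
  case False
  then have "cmod (poly (Epoly b T) (cnj z)) < cmod (poly (Epoly b T) z)"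
    using hermite_biehler_Epoly[OF assms(1)] assms(2) by (simp add: hermite_biehler_def)
  then show ?thesis by auto
qed

lemma has_bochner_integral_poly_quotient_0:
  fixes p q :: "complex poly"
  assumes "\<And>z. Im z \<ge> 0 \<Longrightarrow> poly q z \<noteq> 0" "degree p + 2 \<le> degree q"
  shows "has_bochner_integral lborel (\<lambda>x::real. poly p (of_real x) / poly q (of_real x)) 0"
  using integrable_poly_quotient[of q p] integral_poly_quotient_eq_0[of q p] assms
  by (simp add: has_bochner_integral_iff)

section \<open>Orthonormality on the real line\<close>

text \<open>The first factor carries no conjugate because the polynomials are real on the real line.
  The factor \<open>1 / pi\<close> is left out, so squared norms come out as
  \<open>pi\<close>.\<close>

definition gram_density :: "(nat \<Rightarrow> real) \<Rightarrow> nat \<Rightarrow> nat \<Rightarrow> nat \<Rightarrow> real \<Rightarrow> complex" where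
  "gram_density b T m n x = poly (Ppoly b m) (of_real x) * poly (Ppoly b n) (of_real x) /
     of_real ((cmod (poly (Epoly b T) (of_real x)))\<^sup>2)"

lemma gram_density_0 [simp]: "gram_density b T 0 n = (\<lambda>x. 0)" "gram_density b T m 0 = (\<lambda>x. 0)"
  by (simp_all add: gram_density_def fun_eq_iff)

lemma gram_density_commute: "gram_density b T m n = gram_density b T n m"
  by (simp add: gram_density_def fun_eq_iff mult.commute)

text \<open>On the real line P_(T+1) and P_T are the real and imaginary parts of E. Dividing by
  \<open>E * cnj E\<close> leaves quotients by E alone, which are analytic in the upper half-plane,
  and their conjugates.\<close>

lemma gram_density_top:
  fixes b :: "nat \<Rightarrow> real" and T :: nat and x :: real
  defines "w \<equiv> \<lambda>n. poly (Ppoly b n) (of_real x) / poly (Epoly b T) (of_real x)"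
  assumes "T \<ge> 1"
  shows "gram_density b T (Suc T) n x = (cnj (w n) + w n) / 2"
    and "gram_density b T T n x = (cnj (w n) - w n) / (2 * \<i>)"
proof -
  let ?E = "poly (Epoly b T) (of_real x)" and ?g = "poly (Ppoly b n) (of_real x)"
  let ?A = "poly (Ppoly b (Suc T)) (of_real x)" and ?B = "poly (Ppoly b T) (of_real x)"
  have E: "?E \<noteq> 0" using Epoly_nonzero assms by simp
  have cE: "cnj ?E = ?A - \<i> * ?B" "?E = ?A + \<i> * ?B"
    unfolding poly_Epoly by (simp_all del: Ppoly.simps)
  have w: "w n = ?g * cnj ?E / (?E * cnj ?E)" "cnj (w n) = ?g * ?E / (?E * cnj ?E)"
    using E by (simp_all add: w_def del: Ppoly.simps)
  have ids: "?g * ?E + ?g * cnj ?E = 2 * (?A * ?g)" "?g * ?E - ?g * cnj ?E = 2 * \<i> * (?B * ?g)"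
    unfolding cE by (simp_all add: algebra_simps del: Ppoly.simps)
  have "cnj (w n) + w n = 2 * (?A * ?g) / (?E * cnj ?E)" "cnj (w n) - w n = 2 * \<i> * (?B * ?g) / (?E * cnj ?E)"
    unfolding w(2) unfolding w(1)
    by (simp_all only: add_divide_distrib[symmetric] diff_divide_distrib[symmetric] ids)
  moreover have "gram_density b T m n x = poly (Ppoly b m) (of_real x) * ?g / (?E * cnj ?E)" for m
    by (simp only: gram_density_def complex_norm_square)
  ultimately show "gram_density b T (Suc T) n x = (cnj (w n) + w n) / 2"
    and "gram_density b T T n x = (cnj (w n) - w n) / (2 * \<i>)"
    by (simp_all del: Ppoly.simps complex_mult_cnj)
qed

lemma has_bochner_integral_cnj:
  "has_bochner_integral M f (I :: complex) \<Longrightarrow> has_bochner_integral M (\<lambda>x. cnj (f x)) (cnj I)"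
  by (rule has_bochner_integral_bounded_linear[OF bounded_linear_cnj])

text \<open>For \<open>0 < n < T\<close> the degree of P_n is at most \<open>T - 2\<close>, so P_n /
  E decays quadratically and has integral 0.\<close>

lemma gram_top_less:
  assumes "T \<ge> 1" "n < T"
  shows "has_bochner_integral lborel (gram_density b T (Suc T) n) 0"
    and "has_bochner_integral lborel (gram_density b T T n) 0"
proof -
  let ?w = "\<lambda>x::real. poly (Ppoly b n) (of_real x) / poly (Epoly b T) (of_real x)"
  have w: "has_bochner_integral lborel ?w 0"
  \<comment> \<open>For \<open>n = 0\<close> the degree condition may fail, namely at
    \<open>T = 1\<close>, but the integrand is zero.\<close>
  proof (cases n)
    case (Suc k)
    then show ?thesis
      using assms Epoly_nonzero Epoly_monic Ppoly_monic[of b k]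
      by (intro has_bochner_integral_poly_quotient_0) auto
  qed (simp add: has_bochner_integral_iff)
  have "has_bochner_integral lborel (\<lambda>x. (cnj (?w x) + ?w x) / 2) ((cnj 0 + 0) / 2)"
    by (intro has_bochner_integral_divide has_bochner_integral_add has_bochner_integral_cnj w)
  moreover have "gram_density b T (Suc T) n = (\<lambda>x. (cnj (?w x) + ?w x) / 2)"
    by (rule ext) (rule gram_density_top(1)[OF assms(1)])
  ultimately show "has_bochner_integral lborel (gram_density b T (Suc T) n) 0"
    by (simp only: complex_cnj_zero add_0_left diff_0_right div_0)
  have "has_bochner_integral lborel (\<lambda>x. (cnj (?w x) - ?w x) / (2 * \<i>)) ((cnj 0 - 0) / (2 * \<i>))"
    by (intro has_bochner_integral_divide has_bochner_integral_diff has_bochner_integral_cnj w)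
  moreover have "gram_density b T T n = (\<lambda>x. (cnj (?w x) - ?w x) / (2 * \<i>))"
    by (rule ext) (rule gram_density_top(2)[OF assms(1)])
  ultimately show "has_bochner_integral lborel (gram_density b T T n) 0"
    by (simp only: complex_cnj_zero add_0_left diff_0_right div_0)
qed

text \<open>Here \<open>P\<^sub>T / E\<close> is not integrable; \<open>1 / (z + i)\<close> carries its leading behaviour at infinity.\<close>

lemma gram_top_eq:
  assumes T: "T \<ge> 1"
  shows "has_bochner_integral lborel (gram_density b T T T) (of_real pi)"
proof -
  obtain m where m: "T = Suc m" using T by (cases T) auto
  let ?p = "Ppoly b T * [:\<i>, 1:]" and ?q = "Epoly b T * [:\<i>, 1:]"
  \<comment> \<open>Both polynomials are monic of degree \<open>T\<close>, so the difference drops a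
    degree and \<open>?r / ?q\<close> decays quadratically.\<close>
  let ?r = "?p - Epoly b T"
  have E: "degree (Epoly b T) = T" "coeff (Epoly b T) T = 1" using Epoly_monic[OF T, of b] by auto
  have P: "degree (Ppoly b T) = m" "coeff (Ppoly b T) m = 1"
    using Ppoly_monic[of b m] unfolding m by auto
  have ne: "Epoly b T \<noteq> 0" "Ppoly b T \<noteq> 0" using E P by auto
  have p: "degree ?p = T" "lead_coeff ?p = 1"
    using P ne unfolding m by (subst degree_mult_eq lead_coeff_mult; simp)+
  have q: "degree ?q = T + 1"
    using E ne by (subst degree_mult_eq) auto
  have "degree ?r \<le> T - 1"
  proof (rule degree_le, intro allI impI)
    fix i assume "T - 1 < i"
    then consider "i = T" | "i > T" by linarith
    then show "coeff ?r i = 0"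
      using p E by cases (simp_all add: coeff_eq_0 del: mult_pCons_right)
  qed
  then have deg: "degree ?r + 2 \<le> degree ?q" using q T by linarith
  have q0: "poly ?q z \<noteq> 0" if "Im z \<ge> 0" for z
  proof -
    have "z + \<i> \<noteq> 0" using that by (auto simp: complex_eq_iff)
    moreover have "poly ?q z = poly (Epoly b T) z * (z + \<i>)" by (simp add: algebra_simps)
    ultimately show ?thesis using Epoly_nonzero[OF T that, of b] by (simp only: mult_eq_0_iff) simp
  qed
  let ?v = "\<lambda>x::real. poly ?r (of_real x) / poly ?q (of_real x)"
  have "has_bochner_integral lborel ?v 0"
    by (rule has_bochner_integral_poly_quotient_0[OF q0 deg])
  then have 1: "has_bochner_integral lborel (\<lambda>x. (cnj (?v x) - ?v x) / (2 * \<i>)) ((cnj 0 - 0) / (2 * \<i>))"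
    by (intro has_bochner_integral_divide has_bochner_integral_diff has_bochner_integral_cnj) auto
  \<comment> \<open>This is the contribution of \<open>1 / (z + \<i>)\<close>, whose negative
    imaginary part on the real line is this function.\<close>
  have 2: "has_bochner_integral lborel (\<lambda>x::real. complex_of_real (inverse (1 + x\<^sup>2))) (of_real pi)"
    using integrable_lborel_inverse_1_plus_square integral_lborel_inverse_1_plus_square
    by (intro has_bochner_integral_of_real) (simp add: has_bochner_integral_iff)
  have "gram_density b T T T x = (cnj (?v x) - ?v x) / (2 * \<i>) + complex_of_real (inverse (1 + x\<^sup>2))" for x
  proof -
    let ?E = "poly (Epoly b T) (of_real x)" and ?z = "complex_of_real x"
    have E0: "?E \<noteq> 0" using Epoly_nonzero T by simp
    have z0: "?z + \<i> \<noteq> 0" "?z - \<i> \<noteq> 0" by (auto simp: complex_eq_iff)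
    have split: "p / e = (p * s - e) / (e * s) + 1 / s" if "e \<noteq> 0" "s \<noteq> 0" for p e s :: complex
      using that by (simp add: field_simps)
    have "poly ?r ?z = poly (Ppoly b T) ?z * (?z + \<i>) - ?E" "poly ?q ?z = ?E * (?z + \<i>)"
      by (simp_all add: algebra_simps)
    then have v: "poly (Ppoly b T) ?z / ?E = ?v x + 1 / (?z + \<i>)"
      using split[OF E0 z0(1)] by simp
    have "inverse (1 + ?z\<^sup>2) = (1 / (?z - \<i>) - 1 / (?z + \<i>)) / (2 * \<i>)"
    proof -
      have "1 + ?z\<^sup>2 = (?z - \<i>) * (?z + \<i>)" by (simp add: algebra_simps power2_eq_square)
      moreover have "1 / (?z - \<i>) - 1 / (?z + \<i>) = 2 * \<i> / ((?z - \<i>) * (?z + \<i>))"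
        using z0 by (subst diff_frac_eq) simp_all
      moreover have "2 * \<i> / X / (2 * \<i>) = inverse X" for X
        by (simp add: inverse_eq_divide)
      ultimately show ?thesis by (simp only:)
    qed
    then have "complex_of_real (inverse (1 + x\<^sup>2)) = (cnj (1 / (?z + \<i>)) - 1 / (?z + \<i>)) / (2 * \<i>)"
      by simp
    then show ?thesis
      unfolding gram_density_top(2)[OF T] v
      by (simp only: complex_cnj_add add_diff_add add_divide_distrib)
  qed
  then have "gram_density b T T T = (\<lambda>x. (cnj (?v x) - ?v x) / (2 * \<i>) + complex_of_real (inverse (1 + x\<^sup>2)))"
    by blast
  then show ?thesis
    using has_bochner_integral_add[OF 1 2] by simp
qed

text \<open>Multiplication by the variable is symmetric: expanding it in either factor of P_(j+1)
  P_(k+1) gives the same product.\<close>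

lemma gram_density_step:
  "gram_density b T j (Suc k) x =
     gram_density b T (Suc j) (Suc (Suc k)) x + gram_density b T (Suc j) k x
     + of_real (b (Suc k) - b (Suc j)) * gram_density b T (Suc j) (Suc k) x
     - gram_density b T (Suc (Suc j)) (Suc k) x"
  unfolding gram_density_def poly_Ppoly_step
  by (simp add: algebra_simps add_divide_distrib diff_divide_distrib)

lemma gram_upto:
  assumes "T \<ge> 1" "m \<le> T" "n \<le> m"
  shows "has_bochner_integral lborel (gram_density b T m n) (if m = n \<and> m > 0 then of_real pi else 0)"
proof -
  let ?d = "\<lambda>m n. if m = n \<and> m > 0 then complex_of_real pi else 0"
  \<comment> \<open>The recurrence for row \<open>j\<close> uses rows \<open>j + 1\<close> and
    \<open>j + 2\<close>, so the descending induction carries two rows.\<close>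
  have "(\<forall>n\<le>m. has_bochner_integral lborel (gram_density b T m n) (?d m n)) \<and>
      (\<forall>n<m. has_bochner_integral lborel (gram_density b T (Suc m) n) 0)"
    using \<open>m \<le> T\<close>
  proof (induction rule: inc_induct)
    case base
    show ?case
      using gram_top_less[OF assms(1)] gram_top_eq[OF assms(1)] assms(1) by (auto simp: le_less)
  next
    case (step j)
    have IH: "has_bochner_integral lborel (gram_density b T (Suc j) i) (?d (Suc j) i)" if "i \<le> Suc j" for i
      using step.IH that by blast
    have 1: "has_bochner_integral lborel (gram_density b T j n) (?d j n)" if n: "n \<le> j" for n
    proof (cases n)
      case 0
      then show ?thesis by (auto simp: has_bochner_integral_iff)
    next
      case (Suc k)
      \<comment> \<open>Of the four entries only the one at \<open>Suc j\<close>,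
        \<open>Suc (Suc k)\<close> can lie on the diagonal, which happens exactly for
        \<open>n = j\<close>.\<close>
      have "has_bochner_integral lborel (gram_density b T (Suc j) k) 0"
        "has_bochner_integral lborel (gram_density b T (Suc j) (Suc k)) 0"
        "has_bochner_integral lborel (gram_density b T (Suc (Suc j)) (Suc k)) 0"
        "has_bochner_integral lborel (gram_density b T (Suc j) (Suc (Suc k))) (?d j n)"
        using IH[of k] IH[of "Suc k"] IH[of "Suc (Suc k)"] step.IH n Suc by auto
      then have "has_bochner_integral lborel (\<lambda>x. gram_density b T (Suc j) (Suc (Suc k)) x + gram_density b T (Suc j) k x
          + of_real (b (Suc k) - b (Suc j)) * gram_density b T (Suc j) (Suc k) x
          - gram_density b T (Suc (Suc j)) (Suc k) x)
          (?d j n + 0 + of_real (b (Suc k) - b (Suc j)) * 0 - 0)"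
        by (intro has_bochner_integral_diff has_bochner_integral_add has_bochner_integral_mult_right)
      then show ?thesis
        unfolding gram_density_step[symmetric] using Suc by simp
    qed
    moreover have "has_bochner_integral lborel (gram_density b T (Suc j) n) 0" if "n < j" for n
    proof -
      have "has_bochner_integral lborel (gram_density b T (Suc j) n) (?d (Suc j) n)"
        using that by (intro IH) simp
      then show ?thesis using that by simp
    qed
    ultimately show ?case by blast
  qed
  then show ?thesis using assms(3) by blast
qed

lemma gram_orthonormal:
  assumes "m < T" "n < T"
  shows "has_bochner_integral lborel (gram_density b T (Suc m) (Suc n)) (if m = n then of_real pi else 0)"
proof (cases "n \<le> m")
  case True
  then show ?thesis using gram_upto[of T "Suc m" "Suc n" b] assms by simp
next
  case False
  then show ?thesis
    using gram_upto[of T "Suc n" "Suc m" b] assms by (simp add: gram_density_commute[of b T "Suc m"])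
qed

text \<open>The same expression in the coordinates as in \<open>BJ_inner_Psum\<close>, whence the
  equality of norms.\<close>

lemma de_branges_inner_Psum:
  "de_branges_inner (poly (Epoly b T)) (Psum b T c) (Psum b T d) = (\<Sum>n<T. cnj (c n) * d n)"
proof -
  have "cnj (Psum b T c (of_real x)) * Psum b T d (of_real x) /
        complex_of_real ((cmod (poly (Epoly b T) (of_real x)))\<^sup>2) =
      (\<Sum>m<T. \<Sum>n<T. cnj (c m) * d n * gram_density b T (Suc m) (Suc n) x)" for x
    unfolding Psum_def cnj_sum sum_product sum_divide_distrib gram_density_def
    by (simp add: mult_ac del: Ppoly.simps)
  moreover have "has_bochner_integral lborel
      (\<lambda>x. \<Sum>m<T. \<Sum>n<T. cnj (c m) * d n * gram_density b T (Suc m) (Suc n) x)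
      (\<Sum>m<T. \<Sum>n<T. cnj (c m) * d n * (if m = n then of_real pi else 0))"
    by (intro has_bochner_integral_sum has_bochner_integral_mult_right gram_orthonormal) auto
  moreover have "(\<Sum>m<T. \<Sum>n<T. cnj (c m) * d n * (if m = n then of_real pi else 0)) =
      of_real pi * (\<Sum>m<T. cnj (c m) * d m)"
    by (simp add: if_distrib sum_distrib_left mult_ac cong: if_cong)
  ultimately show ?thesis
    by (simp add: de_branges_inner_def has_bochner_integral_integral_eq)
qed

section \<open>The De Branges space\<close>

lemma nn_integral_le_inverse_1_plus_square:
  assumes "C \<ge> 0" "\<And>x. g x \<le> C / (1 + x\<^sup>2)"
  shows "(\<integral>\<^sup>+x. ennreal (g x) \<partial>lborel) \<le> ennreal (C * pi)"
proof -
  have "(\<integral>\<^sup>+x. ennreal (g x) \<partial>lborel) \<le> (\<integral>\<^sup>+x. ennreal (C * inverse (1 + x\<^sup>2)) \<partial>lborel)"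
    using assms by (intro nn_integral_mono ennreal_leI) (simp add: divide_inverse)
  also have "\<dots> = ennreal (\<integral>x. C * inverse (1 + x\<^sup>2) \<partial>lborel)"
    using assms integrable_lborel_inverse_1_plus_square by (intro nn_integral_eq_integral) auto
  also have "\<dots> = ennreal (C * pi)"
    by (simp add: integral_lborel_inverse_1_plus_square)
  finally show ?thesis .
qed

text \<open>The decay bound on a horizontal line is at most \<open>C / (1 + x^2)\<close> for every
  height \<open>y \<ge> 0\<close>; height 0 gives the integral on the real line.\<close>

lemma poly_quotient_hardy:
  fixes p q :: "complex poly"
  assumes q: "\<And>z. Im z \<ge> 0 \<Longrightarrow> poly q z \<noteq> 0" and deg: "degree p + 1 \<le> degree q"
  shows "(\<lambda>z. poly p z / poly q z) \<in> hardy_H2"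
    and "(\<integral>\<^sup>+x. ennreal ((cmod (poly p (complex_of_real x) / poly q (of_real x)))\<^sup>2) \<partial>lborel) < \<infinity>"
proof -
  have closed: "closed {z. Im z \<ge> 0}" by (rule closed_halfspace_Im_ge)
  obtain C where C: "C > 0" "\<And>z. Im z \<ge> 0 \<Longrightarrow> (cmod (poly p z / poly q z))\<^sup>2 \<le> C / (1 + (cmod z)\<^sup>2) ^ 1"
    using poly_quotient_decay[OF closed _ _ deg] q by (metis mem_Collect_eq)
  have line: "(\<integral>\<^sup>+x. ennreal ((cmod (poly p (Complex x y) / poly q (Complex x y)))\<^sup>2) \<partial>lborel) \<le> ennreal (C * pi)"
    if "y \<ge> 0" for y
  proof (rule nn_integral_le_inverse_1_plus_square)
    fix x
    have "(cmod (poly p (Complex x y) / poly q (Complex x y)))\<^sup>2 \<le> C / (1 + (cmod (Complex x y))\<^sup>2)"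
      using C(2)[of "Complex x y"] that by simp
    also have "\<dots> \<le> C / (1 + x\<^sup>2)"
      using C(1) by (intro divide_left_mono mult_pos_pos) (auto simp: cmod_power2 add_pos_nonneg)
    finally show "(cmod (poly p (Complex x y) / poly q (Complex x y)))\<^sup>2 \<le> C / (1 + x\<^sup>2)" .
  qed (use C in simp)
  have "(SUP y\<in>{0<..}. \<integral>\<^sup>+x. ennreal ((cmod (poly p (Complex x y) / poly q (Complex x y)))\<^sup>2) \<partial>lborel)
      \<le> ennreal (C * pi)"
    using line by (intro SUP_least) auto
  then have "(SUP y\<in>{0<..}. \<integral>\<^sup>+x. ennreal ((cmod (poly p (Complex x y) / poly q (Complex x y)))\<^sup>2) \<partial>lborel) < \<infinity>"
    by (rule le_less_trans) simp
  then show "(\<lambda>z. poly p z / poly q z) \<in> hardy_H2"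
    using q by (auto simp: hardy_H2_def intro!: holomorphic_intros)
  have "(\<integral>\<^sup>+x. ennreal ((cmod (poly p (complex_of_real x) / poly q (of_real x)))\<^sup>2) \<partial>lborel) \<le> ennreal (C * pi)"
    using line[of 0] by (simp add: complex_of_real_def)
  then show "(\<integral>\<^sup>+x. ennreal ((cmod (poly p (complex_of_real x) / poly q (of_real x)))\<^sup>2) \<partial>lborel) < \<infinity>"
    by (rule le_less_trans) simp
qed

lemma poly_in_de_branges:
  assumes T: "T \<ge> 1" and p: "\<And>i. i \<ge> T \<Longrightarrow> coeff p i = 0"
  shows "poly p \<in> de_branges (poly (Epoly b T))"
proof -
  have deg: "degree r + 1 \<le> degree (Epoly b T)" if "\<And>i. i \<ge> T \<Longrightarrow> coeff r i = 0" for r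
  proof -
    have "degree r \<le> T - 1" using that T by (intro degree_le) auto
    then show ?thesis using Epoly_monic(1)[OF T, of b] T by simp
  qed
  have "sharp (poly p) = poly (map_poly cnj p)" by (simp add: sharp_def fun_eq_iff)
  moreover have "degree (map_poly cnj p) + 1 \<le> degree (Epoly b T)"
    using p by (intro deg) (simp add: coeff_map_poly)
  ultimately show ?thesis
    using poly_quotient_hardy[OF Epoly_nonzero[OF T] deg[OF p]]
      poly_quotient_hardy(1)[OF Epoly_nonzero[OF T], where p = "map_poly cnj p"]
    by (auto simp: de_branges_def intro!: holomorphic_intros)
qed

text \<open>The Hardy bounds for F / E and its sharp counterpart control F above and below the real
  line. As E grows with exponent \<open>T\<close>, the growth lemma applies with
  \<open>n = T\<close>.\<close>

lemma de_branges_imp_poly: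
  assumes T: "T \<ge> 1" and F: "F \<in> de_branges (poly (Epoly b T))"
  shows "\<exists>p. F = poly p \<and> (\<forall>i\<ge>T. coeff p i = 0)"
proof -
  let ?E = "poly (Epoly b T)"
  have E0: "?E z \<noteq> 0" if "Im z \<ge> 0" for z using Epoly_nonzero[OF T that] .
  obtain C1 where C1: "C1 \<ge> 0" "\<And>z. Im z > 0 \<Longrightarrow> cmod (F z / ?E z) \<le> C1 / sqrt (Im z)"
    using F hardy_H2_pointwise[of "\<lambda>z. F z / ?E z"] by (auto simp: de_branges_def)
  obtain C2 where C2: "C2 \<ge> 0" "\<And>z. Im z > 0 \<Longrightarrow> cmod (sharp F z / ?E z) \<le> C2 / sqrt (Im z)"
    using F hardy_H2_pointwise[of "\<lambda>z. sharp F z / ?E z"] by (auto simp: de_branges_def)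
  have Q: "poly ([:\<i>, 1:] ^ T) z \<noteq> 0" if "Im z \<ge> 0" for z :: complex
  proof -
    have "\<i> + z \<noteq> 0" using that by (auto simp: complex_eq_iff)
    then show ?thesis by simp
  qed
  have "degree (Epoly b T) \<le> degree ([:\<i>, 1:] ^ T :: complex poly)"
    using Epoly_monic(1)[OF T] by (simp add: degree_linear_power)
  then obtain D where D: "D > 0" "\<And>z. Im z \<ge> 0 \<Longrightarrow> cmod (?E z) \<le> D * cmod (poly ([:\<i>, 1:] ^ T) z)"
    using poly_bound_on_closed[OF closed_halfspace_Im_ge[of 0], of "[:\<i>, 1:] ^ T" "Epoly b T"] Q
    by (metis mem_Collect_eq)
  have growth: "cmod (?E z) \<le> D * (1 + cmod z) ^ T" if "Im z \<ge> 0" for z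
  proof -
    have "cmod (poly ([:\<i>, 1:] ^ T) z) \<le> (1 + cmod z) ^ T"
      using norm_triangle_ineq[of \<i> z] by (auto simp: norm_power intro!: power_mono)
    then show ?thesis using D(1) D(2)[OF that] mult_left_mono[of _ _ D] by (meson less_imp_le order_trans)
  qed
  have transfer: "cmod v \<le> C * D * (1 + cmod z) ^ T / sqrt (Im z)"
    if "Im z > 0" "cmod (v / ?E z) \<le> C / sqrt (Im z)" "C \<ge> 0" for v z C
  proof -
    have "cmod v = cmod (v / ?E z) * cmod (?E z)"
      using E0[of z] that(1) by (simp add: norm_divide)
    also have "\<dots> \<le> (C / sqrt (Im z)) * (D * (1 + cmod z) ^ T)"
      using that growth[of z] by (intro mult_mono) auto
    finally show ?thesis by (simp add: mult_ac)
  qed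
  define C where "C = (C1 + C2) * D"
  have "cmod (F z) \<le> C * (1 + cmod z) ^ T / sqrt \<bar>Im z\<bar>" if "Im z \<noteq> 0" for z
  proof (cases "Im z > 0")
    case True
    then have "cmod (F z / ?E z) \<le> (C1 + C2) / sqrt (Im z)"
      using C1(2)[OF True] C2(1) divide_right_mono[of C1 "C1 + C2" "sqrt (Im z)"] by simp
    then show ?thesis using transfer[OF True, of "F z" "C1 + C2"] C1 C2 True by (simp add: C_def)
  next
    case False
    \<comment> \<open>Below the real line \<open>F z\<close> has the same modulus as
      \<open>sharp F\<close> at the reflected point.\<close>
    then have pos: "Im (cnj z) > 0" using that by simp
    then have "cmod (sharp F (cnj z) / ?E (cnj z)) \<le> (C1 + C2) / sqrt (Im (cnj z))"
      using C2(2)[OF pos] C1(1) divide_right_mono[of C2 "C1 + C2" "sqrt (Im (cnj z))"] by simp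
    then show ?thesis
      using transfer[OF pos, of "sharp F (cnj z)" "C1 + C2"] C1 C2 pos by (simp add: C_def sharp_def)
  qed
  then show ?thesis
    using F C1 C2 D by (intro entire_poly_of_growth[where C = C]) (auto simp: de_branges_def C_def)
qed

theorem mainTheorem3:
  fixes b :: "nat \<Rightarrow> real" and T :: nat
  assumes "T \<ge> 1"
  shows "hilbert_function_space (BJ T) (BJ_inner b T) \<and>
    (\<exists>E. hermite_biehler E \<and> BJ T = de_branges E \<and>
       (\<forall>F\<in>BJ T. ip_norm (BJ_inner b T) F = ip_norm (de_branges_inner E) F)) \<and>
    (\<forall>z. (\<exists>!j. kernel_control b T z j) \<and>
         (\<forall>j. kernel_control b T z j \<longrightarrow>
            (\<forall>K. reproducing_at (BJ T) (BJ_inner b T) z K \<longleftrightarrow> K = Tsum T j)))"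
proof (intro conjI allI impI exI)
  show "hermite_biehler (poly (Epoly b T))" by (rule hermite_biehler_Epoly[OF assms])
  \<comment> \<open>Both sets consist of the polynomials of degree less than
    \<open>T\<close>.\<close>
  show "BJ T = de_branges (poly (Epoly b T))"
    unfolding BJ_eq_polys using poly_in_de_branges[OF assms] de_branges_imp_poly[OF assms] by blast
  show "\<forall>F\<in>BJ T. ip_norm (BJ_inner b T) F = ip_norm (de_branges_inner (poly (Epoly b T))) F"
    by (auto simp: BJ_eq_range_Psum[of T b] ip_norm_def BJ_inner_Psum de_branges_inner_Psum)
qed (rule BJ_hilbert kernel_control_unique_existence reproducing_iff_kernel_control; assumption?)+

end
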